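(* Let $k$ be a positive integer. Every $(10k-3)$-edge-connected essentially $(12k-7)$-edge-connected graph of even order admits a modulo $k$-regular factor whose degrees are not divisible by $2k$. In addition, this result is true for bipartite $(5k-1)$-edge-connected essentially $(6k-3)$-edge-connected graphs of even order (that is, every such graph admits a modulo $k$-regular factor whose degrees are not divisible by $2k$).
   Context: Graphs may have loops and multiple edges. The order of a graph is its number of vertices. A graph $G$ is $\lambda$-edge-connected if, for every nonempty proper subset $A$ of its vertex set, at least $\lambda$ edges have exactly one end in $A$. A graph is essentially $\lambda$-edge-connected if all edges of any edge cut of size strictly less than $\lambda$ are incident with a common vertex. A factor is a spanning subgraph. A modulo $k$-regular graph is a graph whose vertex degrees are positive and divisible by $k$. *)

theory Defs
  imports Main
begin

(* An edge is an element of an abstract set and carries the set of its ends: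
   parallel edges are distinct edges with the same ends, and a loop is an edge
   whose set of ends is a singleton. *)
record ('v, 'e) mgraph =
  verts :: "'v set"
  edges :: "'e set"
  ends :: "'e \<Rightarrow> 'v set"

definition multigraph :: "('v, 'e) mgraph \<Rightarrow> bool" where
  "multigraph G \<longleftrightarrow> finite (verts G) \<and> finite (edges G) \<and>
     (\<forall>e\<in>edges G. ends G e \<subseteq> verts G \<and> (card (ends G e) = 1 \<or> card (ends G e) = 2))"

definition graph_order :: "('v, 'e) mgraph \<Rightarrow> nat" where
  "graph_order G = card (verts G)"

(* The second summand makes a loop contribute 2 to the degree. *)
definition vertex_degree :: "('v, 'e) mgraph \<Rightarrow> 'v \<Rightarrow> nat" where
  "vertex_degree G v = card {e \<in> edges G. v \<in> ends G e} + card {e \<in> edges G. ends G e = {v}}"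

definition edge_cut :: "('v, 'e) mgraph \<Rightarrow> 'v set \<Rightarrow> 'e set" where
  "edge_cut G A = {e \<in> edges G. \<exists>x\<in>A. \<exists>y\<in>verts G - A. ends G e = {x, y}}"

definition edge_connected :: "nat \<Rightarrow> ('v, 'e) mgraph \<Rightarrow> bool" where
  "edge_connected l G \<longleftrightarrow>
     (\<forall>A. A \<noteq> {} \<and> A \<subset> verts G \<longrightarrow> l \<le> card (edge_cut G A))"

definition essentially_edge_connected :: "nat \<Rightarrow> ('v, 'e) mgraph \<Rightarrow> bool" where
  "essentially_edge_connected l G \<longleftrightarrow>
     (\<forall>A. A \<noteq> {} \<and> A \<subset> verts G \<and> card (edge_cut G A) < l \<longrightarrow>
        (\<exists>v\<in>verts G. \<forall>e\<in>edge_cut G A. v \<in> ends G e))"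

definition bipartite :: "('v, 'e) mgraph \<Rightarrow> bool" where
  "bipartite G \<longleftrightarrow>
     (\<exists>X Y. X \<inter> Y = {} \<and> X \<union> Y = verts G \<and>
        (\<forall>e\<in>edges G. \<exists>x\<in>X. \<exists>y\<in>Y. ends G e = {x, y}))"

definition is_factor :: "('v, 'e) mgraph \<Rightarrow> ('v, 'e) mgraph \<Rightarrow> bool" where
  "is_factor F G \<longleftrightarrow> multigraph F \<and> verts F = verts G \<and> edges F \<subseteq> edges G \<and>
     (\<forall>e\<in>edges F. ends F e = ends G e)"

definition modulo_regular :: "nat \<Rightarrow> ('v, 'e) mgraph \<Rightarrow> bool" where
  "modulo_regular k G \<longleftrightarrow> (\<forall>v\<in>verts G. vertex_degree G v > 0 \<and> k dvd vertex_degree G v)"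

end

theory Submission
  imports Defs
begin

text \<open>
  A spanning subgraph of a bipartite graph with parts \<open>X\<close> and \<open>Y\<close> is the same as an orientation: direct its
  edges from \<open>X\<close> to \<open>Y\<close> and the others from \<open>Y\<close> to \<open>X\<close>. Degrees congruent to \<open>k\<close> modulo \<open>2 * k\<close> then become
  prescribed values of outdegree minus indegree modulo \<open>4 * k\<close>, and such an orientation is provided by
  the modulo orientation theorem of Lovasz, Thomassen, Wu and Zhang with modulus \<open>m = 2 * k\<close>, which needs
  \<open>d(A) \<ge> 2 * m - 2 + \<tau>(A)\<close>, where \<open>\<tau>(A)\<close> is the distance from the total demand of \<open>A\<close> to the
  multiples of \<open>2 * m\<close>. Since \<open>\<tau>(A) \<le> m\<close>, only cuts of size \<open>n < 6 * k - 3\<close> matter. Their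
  edges share a vertex, so all of them have their end in \<open>A\<close> in the same part; hence \<open>\<tau>(A)\<close> is the distance
  of \<open>n\<close> or \<open>n + 2 * k\<close> to the multiples of \<open>4 * k\<close>, and \<open>n \<ge> 5 * k - 1\<close> is exactly what is needed.
  A general graph is reduced to a bipartite one by a maximum cut, which keeps at least half of
  every edge cut.

  The orientation theorem is proved for graphs with a root whose edges are already directed, by
  induction. Tight sets are contracted. Without tight sets, a vertex of demand 0 is removed by
  lifting pairs of its edges, and an edge from a vertex of positive to one of negative demand is
  directed and deleted. If all demands are positive, edges directed into the root are deleted, and
  once none is left, some demands are made negative by inserting artificial ones.\<close>

subsection \<open>Distance to the multiples of an integer\<close>

text \<open>For \<open>M = 2 * m\<close> and \<open>x\<close> the total demand of \<open>A\<close>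
  this is the quantity \<open>\<tau>(A)\<close> of the orientation theorem.\<close>

definition dist_mult :: "int \<Rightarrow> int \<Rightarrow> int" where
  "dist_mult M x = min (x mod M) (M - x mod M)"

lemma dist_mult_nonneg: "M > 0 \<Longrightarrow> 0 \<le> dist_mult M x"
  by (simp add: dist_mult_def order_less_imp_le)

lemma dist_mult_le_half: "2 * dist_mult M x \<le> M"
  by (simp add: dist_mult_def min_def)

lemma dist_mult_cong: "M dvd x - y \<Longrightarrow> dist_mult M x = dist_mult M y"
  using mod_eq_dvd_iff[of x M y] by (simp add: dist_mult_def)

lemma dist_mult_eq_abs:
  assumes "M > 0" "2 * \<bar>x\<bar> \<le> M"
  shows "dist_mult M x = \<bar>x\<bar>"
proof (cases "x \<ge> 0")
  case True
  then show ?thesis using assms by (cases "x = M") (auto simp: dist_mult_def min_def)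
next
  case False
  then have "x mod M = x + M"
    using assms by (intro int_mod_pos_eq[where q = "-1"]) auto
  then show ?thesis using False assms by (simp add: dist_mult_def min_def)
qed

lemma dist_mult_attained:
  assumes "M > 0"
  obtains j where "dist_mult M x = \<bar>x - M * j\<bar>"
proof (cases "x mod M \<le> M - x mod M")
  case True
  have "x mod M = x - M * (x div M)" by (simp add: minus_mult_div_eq_mod)
  moreover have "x mod M \<ge> 0" using assms by simp
  ultimately show ?thesis using True that[of "x div M"] by (simp add: dist_mult_def)
next
  case False
  have "x mod M = x - M * (x div M)" by (simp add: minus_mult_div_eq_mod)
  moreover have "x mod M < M" using assms by simp
  moreover have "x - M * (x div M + 1) = x - M * (x div M) - M" by (simp add: algebra_simps)
  ultimately have "dist_mult M x = \<bar>x - M * (x div M + 1)\<bar>" using False by (simp add: dist_mult_def)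
  then show ?thesis by (rule that)
qed

lemma dist_mult_le_abs:
  assumes "M > 0"
  shows "dist_mult M x \<le> \<bar>x\<bar>"
proof (cases "2 * \<bar>x\<bar> \<le> M")
  case True then show ?thesis using assms by (simp add: dist_mult_eq_abs)
next
  case False then show ?thesis using dist_mult_le_half[of M x] by linarith
qed

lemma dist_mult_add:
  assumes "M > 0"
  shows "dist_mult M (x + y) \<le> dist_mult M x + dist_mult M y"
proof -
  obtain i j where ij: "dist_mult M x = \<bar>x - M * i\<bar>" "dist_mult M y = \<bar>y - M * j\<bar>"
    using dist_mult_attained[OF assms] by metis
  have "dist_mult M (x + y) = dist_mult M ((x - M * i) + (y - M * j))"
    by (rule dist_mult_cong) (simp add: algebra_simps flip: distrib_left)
  also have "\<dots> \<le> \<bar>(x - M * i) + (y - M * j)\<bar>" by (rule dist_mult_le_abs[OF assms])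
  finally show ?thesis using ij by linarith
qed

lemma dist_mult_add_le:
  assumes "M > 0"
  shows "dist_mult M (x + y) \<le> dist_mult M x + \<bar>y\<bar>"
  using dist_mult_add[OF assms, of x y] dist_mult_le_abs[OF assms, of y] by linarith

lemma dist_mult_minus:
  assumes "M > 0"
  shows "dist_mult M (- x) = dist_mult M x"
proof -
  have "dist_mult M (- y) \<le> dist_mult M y" for y
  proof -
    obtain j where "dist_mult M y = \<bar>y - M * j\<bar>" using dist_mult_attained[OF assms] .
    moreover have "dist_mult M (- y) = dist_mult M (- (y - M * j))"
      by (rule dist_mult_cong) simp
    ultimately show ?thesis using dist_mult_le_abs[OF assms, of "- (y - M * j)"] by simp
  qed
  from this[of x] this[of "- x"] show ?thesis by simp
qed

text \<open>Up to sign, the distance differs from \<open>x\<close> by a multiple of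
  \<open>M\<close>. Together with the parity condition on degrees this turns an inequality that
  fails or is strict by 1 into one with a gap of 2.\<close>

lemma even_dist_mult:
  assumes "even M"
  shows "even (dist_mult M x) \<longleftrightarrow> even x"
proof -
  have "even (x mod M) \<longleftrightarrow> even x" using assms by (simp add: dvd_mod_iff)
  then show ?thesis using assms by (simp add: dist_mult_def min_def)
qed

text \<open>Residues in the lower half, with the middle included, are the positive demands:
  directing an edge out of such a vertex costs one degree and one unit of distance, so its slack is
  kept. The next lemma is the mirror image for negative demands, with the middle belonging to
  both.\<close>

lemma dist_mult_diff_one:
  assumes "0 < x mod M" "2 * (x mod M) \<le> M"
  shows "dist_mult M x = x mod M" "dist_mult M (x - 1) = x mod M - 1"
proof -
  show "dist_mult M x = x mod M" using assms by (simp add: dist_mult_def min_def)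
  have "M > 0" using assms by linarith
  have "dist_mult M (x - 1) = dist_mult M (x mod M - 1)"
    by (rule dist_mult_cong) (simp add: mod_eq_dvd_iff[symmetric])
  then show "dist_mult M (x - 1) = x mod M - 1" using assms \<open>M > 0\<close> by (simp add: dist_mult_eq_abs)
qed

lemma dist_mult_add_one:
  assumes "M > 0" "2 * (x mod M) \<ge> M"
  shows "dist_mult M x = M - x mod M" "dist_mult M (x + 1) = M - x mod M - 1"
proof -
  show "dist_mult M x = M - x mod M" using assms by (simp add: dist_mult_def min_def)
  have "x mod M < M" using assms by simp
  have "dist_mult M (x + 1) = dist_mult M (x mod M - M + 1)"
    by (rule dist_mult_cong) (simp add: algebra_simps mod_eq_dvd_iff[symmetric])
  then show "dist_mult M (x + 1) = M - x mod M - 1"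
    using assms \<open>x mod M < M\<close> by (simp add: dist_mult_eq_abs)
qed

subsection \<open>Weighted graphs with a pre-oriented root\<close>

definition cut_weight :: "'a set \<Rightarrow> ('a \<Rightarrow> 'a \<Rightarrow> int) \<Rightarrow> 'a set \<Rightarrow> int" where
  "cut_weight V c A = (\<Sum>a\<in>A. \<Sum>u\<in>V - A. c a u)"

text \<open>The degree of \<open>A\<close> in the graph with the root, which lies outside every
  \<open>A\<close>: edges to the rest of \<open>V\<close> and root edges of either
  direction.\<close>

definition boundary_degree :: "'a set \<Rightarrow> ('a \<Rightarrow> 'a \<Rightarrow> int) \<Rightarrow> ('a \<Rightarrow> int) \<Rightarrow> ('a \<Rightarrow> int) \<Rightarrow> 'a set \<Rightarrow> int" where
  "boundary_degree V c p q A = cut_weight V c A + sum p A + sum q A"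

text \<open>Outdegree minus indegree, but without the root edges. Hence \<open>solution\<close>
  compares it with \<open>b v + p v - q v\<close> and not with \<open>b v\<close>. The diagonal of
  \<open>f\<close> cancels.\<close>

definition net :: "'a set \<Rightarrow> ('a \<Rightarrow> 'a \<Rightarrow> int) \<Rightarrow> 'a \<Rightarrow> int" where
  "net V f v = (\<Sum>u\<in>V. f v u - f u v)"

definition ind :: "'a \<Rightarrow> 'a \<Rightarrow> int" where
  "ind x v = of_bool (v = x)"

definition arc :: "'a \<Rightarrow> 'a \<Rightarrow> 'a \<Rightarrow> 'a \<Rightarrow> int" where
  "arc x y u v = of_bool (u = x \<and> v = y)"

definition edge :: "'a \<Rightarrow> 'a \<Rightarrow> 'a \<Rightarrow> 'a \<Rightarrow> int" where
  "edge x y u v = arc x y u v + arc y x u v"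

text \<open>
  The graph lives on \<open>V\<close> together with one further vertex, the root. Between \<open>u\<close> and \<open>v\<close>
  there are \<open>c u v\<close> parallel edges (the diagonal of \<open>c\<close> is junk); \<open>p v\<close> edges are already directed
  from the root to \<open>v\<close> and \<open>q v\<close> from \<open>v\<close> to the root. The demand \<open>b v\<close> is the wanted outdegree
  minus indegree modulo \<open>2 * m\<close>, with root edges counted. The single set \<open>{x0}\<close> may violate
  the cut condition, but only when its demand vanishes.\<close>

definition admissible where
  "admissible m V c p q b x0 \<longleftrightarrow> finite V \<and>
     (\<forall>u v. c u v = c v u \<and> 0 \<le> c u v) \<and> (\<forall>v. 0 \<le> p v \<and> 0 \<le> q v) \<and>
     2 * m dvd (\<Sum>v\<in>V. b v + p v - q v) \<and>
     (\<forall>A\<subseteq>V. even (boundary_degree V c p q A - sum b A)) \<and>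
     sum p V + sum q V \<le> 2 * m - 2 + dist_mult (2 * m) (sum p V - sum q V) \<and>
     (\<forall>A. A \<noteq> {} \<and> A \<subset> V \<and> \<not> (A = {x0} \<and> 2 * m dvd b x0) \<longrightarrow>
        2 * m - 2 + dist_mult (2 * m) (sum b A) \<le> boundary_degree V c p q A)"

text \<open>\<open>f u v\<close> is the number of edges between \<open>u\<close> and \<open>v\<close> directed from \<open>u\<close> to \<open>v\<close>.\<close>

definition solution where
  "solution m V c p q b f \<longleftrightarrow>
     (\<forall>u\<in>V. \<forall>v\<in>V. u \<noteq> v \<longrightarrow> 0 \<le> f u v \<and> f u v + f v u = c u v) \<and>
     (\<forall>v\<in>V. 2 * m dvd net V f v - (b v + p v - q v))"

section \<open>Basic facts on admissible graphs, single arcs and cuts\<close>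

lemma admissible_graph:
  assumes "admissible m V c p q b x0"
  shows "(\<forall>u v. c u v = c v u \<and> 0 \<le> c u v) \<and> (\<forall>v. 0 \<le> p v \<and> 0 \<le> q v)"
  using assms unfolding admissible_def by (elim conjE) (intro conjI; assumption)

lemma admissible_sym:
  assumes "admissible m V c p q b x0"
  shows "c u v = c v u"
  using admissible_graph[OF assms, THEN conjunct1] by (elim allE[of _ u] allE[of _ v] conjE)

lemma admissible_nonneg:
  assumes "admissible m V c p q b x0"
  shows "0 \<le> c u v" "0 \<le> p v" "0 \<le> q v"
  using admissible_graph[OF assms, THEN conjunct1, rule_format, of u v]
    admissible_graph[OF assms, THEN conjunct2, rule_format, of v] by simp_all

lemma solutionD:
  assumes "solution m V c p q b f"
  shows "u \<in> V \<Longrightarrow> v \<in> V \<Longrightarrow> u \<noteq> v \<Longrightarrow> 0 \<le> f u v"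
    "u \<in> V \<Longrightarrow> v \<in> V \<Longrightarrow> u \<noteq> v \<Longrightarrow> f u v + f v u = c u v"
    "v \<in> V \<Longrightarrow> 2 * m dvd net V f v - (b v + p v - q v)"
  using assms unfolding solution_def by blast+

lemma sum_ind: "finite A \<Longrightarrow> sum (ind x) A = of_bool (x \<in> A)"
  by (simp add: ind_def of_bool_def sum.delta)

lemma net_arc:
  assumes "finite V" "x \<in> V" "y \<in> V"
  shows "net V (arc x y) v = ind x v - ind y v"
proof -
  have "(\<Sum>u\<in>V. arc x y v u) = ind x v" using assms sum_ind[of V y]
    by (cases "v = x") (auto simp: arc_def ind_def)
  moreover have "(\<Sum>u\<in>V. arc x y u v) = ind y v" using assms sum_ind[of V x]
    by (cases "v = y") (auto simp: arc_def ind_def)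
  ultimately show ?thesis by (simp add: net_def sum_subtractf)
qed

lemma net_add: "net V (\<lambda>u v. f u v + g u v) v = net V f v + net V g v"
  by (simp add: net_def sum.distrib sum_subtractf)

lemma net_diff: "net V (\<lambda>u v. f u v - g u v) v = net V f v - net V g v"
  by (simp add: net_def sum_subtractf)

lemma cut_weight_add: "cut_weight V (\<lambda>u v. c u v + d u v) A = cut_weight V c A + cut_weight V d A"
  by (simp add: cut_weight_def sum.distrib)

lemma cut_weight_diff: "cut_weight V (\<lambda>u v. c u v - d u v) A = cut_weight V c A - cut_weight V d A"
  by (simp add: cut_weight_def sum_subtractf)

lemma cut_weight_edge:
  assumes "finite V" "A \<subseteq> V" "x \<in> V" "y \<in> V"
  shows "cut_weight V (edge x y) A = of_bool ((x \<in> A) \<noteq> (y \<in> A))"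
proof -
  have fin: "finite A" "finite (V - A)" using assms finite_subset by auto
  have "cut_weight V (arc x y) A = of_bool (x \<in> A \<and> y \<notin> A)" if "x \<in> V" "y \<in> V" for x y
  proof -
    have "cut_weight V (arc x y) A = (\<Sum>a\<in>A. \<Sum>u\<in>V - A. ind x a * ind y u)"
      by (simp add: cut_weight_def arc_def ind_def of_bool_conj)
    also have "\<dots> = sum (ind x) A * sum (ind y) (V - A)"
      by (simp add: sum_product)
    also have "\<dots> = of_bool (x \<in> A \<and> y \<notin> A)" using fin that by (simp add: sum_ind)
    finally show ?thesis .
  qed
  then show ?thesis using assms(3,4) unfolding edge_def cut_weight_add by auto
qed

lemma cut_weight_compl:
  assumes "A \<subseteq> V" "\<And>u v. c u v = c v u"
  shows "cut_weight V c (V - A) = cut_weight V c A"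
proof -
  have "V - (V - A) = A" using assms(1) by auto
  then show ?thesis unfolding cut_weight_def using assms(2)
    by (subst sum.swap) simp
qed


lemma arc_swap: "arc x y u v = arc y x v u"
  by (simp add: arc_def conj_commute)

lemma arc_nonneg: "0 \<le> arc x y u v"
  by (simp add: arc_def)

text \<open>Puts back a deleted edge, directed from \<open>w\<close> to \<open>y\<close>. Only the
  combination \<open>b + p - q\<close> is constrained, so a reduction is free to move amounts
  between the demand of a vertex and its root edges.\<close>

lemma solution_arc:
  assumes "finite V" "w \<in> V" "y \<in> V" "w \<noteq> y"
    and sol: "solution m V (\<lambda>u v. c u v - edge w y u v) p' q' b' f"
    and eq: "\<And>v. b' v + p' v - q' v = b v + p v - q v - ind w v + ind y v"
  shows "solution m V c p q b (\<lambda>u v. f u v + arc w y u v)"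
  unfolding solution_def
proof (intro conjI ballI impI)
  fix u v assume uv: "u \<in> V" "v \<in> V" "u \<noteq> v"
  note uv' = solutionD(1,2)[OF sol uv]
  show "0 \<le> f u v + arc w y u v" using uv' by (simp add: arc_def)
  show "f u v + arc w y u v + (f v u + arc w y v u) = c u v"
    using uv' arc_swap[of w y v u] unfolding edge_def by linarith
next
  fix v assume "v \<in> V"
  then have "2 * m dvd net V f v - (b' v + p' v - q' v)"
    by (rule solutionD(3)[OF sol])
  moreover have "net V (\<lambda>u v. f u v + arc w y u v) v - (b v + p v - q v)
      = net V f v - (b' v + p' v - q' v)"
    using eq[of v] net_arc[OF assms(1-3), of v] by (simp add: net_add)
  ultimately show "2 * m dvd net V (\<lambda>u v. f u v + arc w y u v) v - (b v + p v - q v)"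
    by simp
qed

text \<open>
  Every reduction below changes the slack of a set with at least two vertices by at most 2. By parity
  this is harmless as soon as no such set is tight.\<close>

lemma admissible_step:
  assumes adm: "admissible m V c p q b x0"
    and slack: "\<And>A. A \<subset> V \<Longrightarrow> 2 \<le> card A \<Longrightarrow> 2 * m + dist_mult (2 * m) (sum b A) \<le> boundary_degree V c p q A"
    and c': "\<And>u v. c' u v = c' v u" "\<And>u v. 0 \<le> c' u v"
    and pq': "\<And>v. 0 \<le> p' v" "\<And>v. 0 \<le> q' v"
    and tot: "(\<Sum>v\<in>V. b' v + p' v - q' v) = (\<Sum>v\<in>V. b v + p v - q v)"
    and par: "\<And>A. A \<subseteq> V \<Longrightarrow> even (boundary_degree V c' p' q' A - boundary_degree V c p q A - (sum b' A - sum b A))"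
    and root: "sum p' V + sum q' V \<le> 2 * m - 2 + dist_mult (2 * m) (sum p' V - sum q' V)"
    and single: "\<And>v. v \<in> V \<Longrightarrow> V \<noteq> {v} \<Longrightarrow> \<not> (v = x1 \<and> 2 * m dvd b' v) \<Longrightarrow>
      2 * m - 2 + dist_mult (2 * m) (b' v) \<le> boundary_degree V c' p' q' {v}"
    and sets: "\<And>A. A \<subset> V \<Longrightarrow> 2 \<le> card A \<Longrightarrow>
      boundary_degree V c p q A - 2 - dist_mult (2 * m) (sum b A) \<le> boundary_degree V c' p' q' A - dist_mult (2 * m) (sum b' A)"
  shows "admissible m V c' p' q' b' x1"
  unfolding admissible_def
proof (intro conjI allI impI)
  show "finite V" "2 * m dvd (\<Sum>v\<in>V. b' v + p' v - q' v)"
    using adm tot by (simp_all add: admissible_def)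
next
  fix A assume "A \<subseteq> V"
  then have "even (boundary_degree V c p q A - sum b A)" using adm by (simp add: admissible_def)
  moreover have "boundary_degree V c' p' q' A - sum b' A = (boundary_degree V c' p' q' A - boundary_degree V c p q A - (sum b' A - sum b A))
      + (boundary_degree V c p q A - sum b A)" by simp
  ultimately show "even (boundary_degree V c' p' q' A - sum b' A)" using par[OF \<open>A \<subseteq> V\<close>] by (metis dvd_add)
next
  fix A assume A: "A \<noteq> {} \<and> A \<subset> V \<and> \<not> (A = {x1} \<and> 2 * m dvd b' x1)"
  have "finite A" using A adm by (meson admissible_def finite_subset psubset_imp_subset)
  show "2 * m - 2 + dist_mult (2 * m) (sum b' A) \<le> boundary_degree V c' p' q' A"
  proof (cases "2 \<le> card A")
    case True
    then show ?thesis using slack[of A] sets[of A] A by linarith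
  next
    case False
    moreover have "0 < card A" using A \<open>finite A\<close> by (simp add: card_gt_0_iff)
    ultimately have "card A = 1" by linarith
    then obtain v where "A = {v}" by (rule card_1_singletonE)
    then have "v \<in> V" "V \<noteq> {v}" "\<not> (v = x1 \<and> 2 * m dvd b' v)" using A by auto
    from single[OF this] show ?thesis using \<open>A = {v}\<close> by simp
  qed
qed (rule c' pq' root)+

section \<open>Directing one edge, and reversing all directions\<close>

lemma edge_le:
  assumes "\<And>u v. c u v = c v u" "\<And>u v. 0 \<le> c u v" "x \<noteq> y" "1 \<le> c x y"
  shows "edge x y u v \<le> c u v"
proof -
  have "1 \<le> c y x" using assms(1)[of y x] assms(4) by linarith
  then show ?thesis using assms(2)[of u v] assms(3,4)
    by (cases "u = x \<and> v = y"; cases "u = y \<and> v = x") (auto simp: edge_def arc_def)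
qed

lemma edge_commute: "edge x y u v = edge x y v u"
  unfolding edge_def using arc_swap[of x y u v] arc_swap[of y x u v] by linarith

lemma admissible_singleton:
  assumes "admissible m V c p q b x0" "v \<in> V" "V \<noteq> {v}" "\<not> (v = x0 \<and> 2 * m dvd b v)"
  shows "2 * m - 2 + dist_mult (2 * m) (b v) \<le> boundary_degree V c p q {v}"
proof -
  have "\<forall>A. A \<noteq> {} \<and> A \<subset> V \<and> \<not> (A = {x0} \<and> 2 * m dvd b x0) \<longrightarrow>
      2 * m - 2 + dist_mult (2 * m) (sum b A) \<le> boundary_degree V c p q A"
    using assms(1) unfolding admissible_def by (elim conjE)
  from spec[OF this, of "{v}"] show ?thesis using assms(2-4) by auto
qed

text \<open>
  Besides directing one edge from \<open>w\<close> to \<open>y\<close>, this inserts \<open>g\<close> artificial edges from \<open>y\<close> to the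
  root, compensated in the demand of \<open>y\<close>. They serve to push the demand of \<open>y\<close> up to \<open>m\<close>,
  where it may be read as negative, so that a further edge into \<open>y\<close> costs nothing.\<close>

lemma admissible_orient:
  assumes adm: "admissible m V c p q b x0" and m: "m > 0"
    and slack: "\<And>A. A \<subset> V \<Longrightarrow> 2 \<le> card A \<Longrightarrow> 2 * m + dist_mult (2 * m) (sum b A) \<le> boundary_degree V c p q A"
    and nz: "\<And>v. v \<in> V \<Longrightarrow> \<not> 2 * m dvd b v"
    and wy: "w \<in> V" "y \<in> V" "w \<noteq> y" "c w y \<ge> 1"
    and g: "0 \<le> g"
    and w: "dist_mult (2 * m) (b w - 1) \<le> dist_mult (2 * m) (b w) - 1"
    and y: "dist_mult (2 * m) (b y + g + 1) \<le> dist_mult (2 * m) (b y) + g - 1"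
    and root: "sum p V + sum q V + g \<le> 2 * m - 2 + dist_mult (2 * m) (sum p V - sum q V - g)"
  shows "admissible m V (\<lambda>u v. c u v - edge w y u v) p (\<lambda>v. q v + g * ind y v)
           (\<lambda>v. b v - ind w v + (g + 1) * ind y v) x0"
proof (rule admissible_step[OF adm slack])
  have fV: "finite V" using adm by (simp add: admissible_def)
  have sumb: "sum (\<lambda>v. b v - ind w v + (g + 1) * ind y v) A
      = sum b A - of_bool (w \<in> A) + (g + 1) * of_bool (y \<in> A)" if "A \<subseteq> V" for A
    using that fV by (simp add: sum.distrib sum_subtractf sum_ind finite_subset flip: sum_distrib_left)
  have deg: "boundary_degree V (\<lambda>u v. c u v - edge w y u v) p (\<lambda>v. q v + g * ind y v) A
      = boundary_degree V c p q A - of_bool ((w \<in> A) \<noteq> (y \<in> A)) + g * of_bool (y \<in> A)" if "A \<subseteq> V" for A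
    using that fV wy by (simp add: boundary_degree_def cut_weight_diff cut_weight_edge sum.distrib sum_ind finite_subset flip: sum_distrib_left)
  show "(\<Sum>v\<in>V. b v - ind w v + (g + 1) * ind y v + p v - (q v + g * ind y v)) = (\<Sum>v\<in>V. b v + p v - q v)"
    using fV wy by (simp add: sum.distrib sum_subtractf sum_ind flip: sum_distrib_left)
  show "even (boundary_degree V (\<lambda>u v. c u v - edge w y u v) p (\<lambda>v. q v + g * ind y v) A - boundary_degree V c p q A -
      (sum (\<lambda>v. b v - ind w v + (g + 1) * ind y v) A - sum b A))" if "A \<subseteq> V" for A
    unfolding sumb[OF that] deg[OF that] by auto
  show "sum p V + (\<Sum>v\<in>V. q v + g * ind y v) \<le> 2 * m - 2 + dist_mult (2 * m) (sum p V - (\<Sum>v\<in>V. q v + g * ind y v))"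
    using root fV wy by (simp add: sum.distrib sum_ind algebra_simps flip: sum_distrib_left)
  show "2 * m - 2 + dist_mult (2 * m) (b v - ind w v + (g + 1) * ind y v)
      \<le> boundary_degree V (\<lambda>u v. c u v - edge w y u v) p (\<lambda>v. q v + g * ind y v) {v}" if v: "v \<in> V" "V \<noteq> {v}" for v
  proof -
    have old: "2 * m - 2 + dist_mult (2 * m) (b v) \<le> boundary_degree V c p q {v}"
      using admissible_singleton[OF adm v] nz[OF v(1)] by blast
    have new: "boundary_degree V (\<lambda>u v. c u v - edge w y u v) p (\<lambda>v. q v + g * ind y v) {v}
      = boundary_degree V c p q {v} - of_bool ((w = v) \<noteq> (y = v)) + g * of_bool (y = v)"
      using deg[of "{v}"] v by simp
    consider "v = w" | "v = y" | "v \<noteq> w" "v \<noteq> y" by auto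
    then show ?thesis
    proof cases
      case 1
      then show ?thesis using old w \<open>w \<noteq> y\<close> unfolding new by (simp add: ind_def)
    next
      case 2
      then have e: "b v - ind w v + (g + 1) * ind y v = b y + g + 1"
        using \<open>w \<noteq> y\<close> by (simp add: ind_def)
      show ?thesis using 2 old y \<open>w \<noteq> y\<close> unfolding new e by simp
    next
      case 3
      then show ?thesis using old unfolding new by (simp add: ind_def)
    qed
  qed
  show "boundary_degree V c p q A - 2 - dist_mult (2 * m) (sum b A)
      \<le> boundary_degree V (\<lambda>u v. c u v - edge w y u v) p (\<lambda>v. q v + g * ind y v) A -
         dist_mult (2 * m) (sum (\<lambda>v. b v - ind w v + (g + 1) * ind y v) A)" if "A \<subset> V" for A
  proof -
    have A: "A \<subseteq> V" using that by auto
    \<comment> \<open>The change in the demand of \<open>A\<close>. The artificial edges raise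
      degree and demand of a set containing \<open>y\<close> by the same \<open>g\<close> and so
      cancel; what remains is a loss of at most 2, one for the edge leaving the cut and one for the
      unit of demand that it carried.\<close>
    define k where "k = - of_bool (w \<in> A) + (g + 1) * of_bool (y \<in> A)"
    have "dist_mult (2 * m) (sum b A + k) \<le> dist_mult (2 * m) (sum b A) + \<bar>k\<bar>"
      using m by (intro dist_mult_add_le) simp
    moreover have "\<bar>k\<bar> \<le> 2 - of_bool ((w \<in> A) \<noteq> (y \<in> A)) + g * of_bool (y \<in> A)"
      using g by (cases "w \<in> A"; cases "y \<in> A") (simp_all add: k_def)
    moreover have k: "sum (\<lambda>v. b v - ind w v + (g + 1) * ind y v) A = sum b A + k"
      unfolding sumb[OF A] k_def by simp
    ultimately show ?thesis unfolding deg[OF A] k by linarith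
  qed
  note c = admissible_sym[OF adm] admissible_nonneg(1)[OF adm]
  show "c u v - edge w y u v = c v u - edge w y v u" for u v
    unfolding c(1)[of u v] edge_commute[of w y u v] ..
  show "0 \<le> c u v - edge w y u v" for u v
    using edge_le[of c w y u v] c wy by simp
  show "0 \<le> p v" "0 \<le> q v + g * ind y v" for v
    using admissible_nonneg[OF adm] g by (simp_all add: ind_def)
qed

text \<open>Reversing every direction negates the demands and exchanges the two kinds of root edges,
  while degrees and distances stay. This halves the case analysis: arcs into the root and negative
  demands are handled as their mirror images.\<close>

lemma admissible_flip:
  assumes "admissible m V c p q b x0" "m > 0"
  shows "admissible m V c q p (\<lambda>v. - b v) x0"
proof -
  have "(\<Sum>v\<in>V. - b v + q v - p v) = - (\<Sum>v\<in>V. b v + p v - q v)"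
    unfolding sum_negf[symmetric] by (rule sum.cong) auto
  moreover have "boundary_degree V c q p A = boundary_degree V c p q A" for A by (simp add: boundary_degree_def)
  moreover have "dist_mult (2 * m) (sum q V - sum p V) = dist_mult (2 * m) (sum p V - sum q V)"
    using dist_mult_minus[of "2 * m" "sum p V - sum q V"] \<open>m > 0\<close> by simp
  moreover have "dist_mult (2 * m) (\<Sum>v\<in>A. - b v) = dist_mult (2 * m) (sum b A)" for A
    using dist_mult_minus[of "2 * m" "sum b A"] \<open>m > 0\<close> by (simp add: sum_negf)
  moreover have "even (boundary_degree V c p q A - (\<Sum>v\<in>A. - b v)) \<longleftrightarrow> even (boundary_degree V c p q A - sum b A)" for A
    by (simp add: sum_negf)
  ultimately show ?thesis using assms(1) unfolding admissible_def by (simp add: add.commute)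
qed

lemma solution_flip:
  assumes "solution m V c q p (\<lambda>v. - b v) f" "\<And>u v. c u v = c v u"
  shows "solution m V c p q b (\<lambda>u v. f v u)"
proof -
  have "net V (\<lambda>u v. f v u) v - (b v + p v - q v) = - (net V f v - (- b v + q v - p v))" for v
    by (simp add: net_def sum_subtractf)
  then show ?thesis
    using solutionD[OF assms(1)] assms(2) unfolding solution_def
    by (metis add.commute dvd_minus_iff)
qed

section \<open>Lifting edges at a vertex of zero demand\<close>

text \<open>An arc from the root to \<open>x\<close> and an edge between \<open>x\<close> and
  \<open>s\<close> become one arc from the root to \<open>s\<close>. Since the root is never in
  \<open>A\<close>, only sets containing \<open>x\<close> but not \<open>s\<close> lose degree,
  namely 2. Among the singletons this is \<open>{x}\<close> alone, which is exempt.\<close>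

lemma admissible_lift_root:
  assumes adm: "admissible m V c p q b x"
    and slack: "\<And>A. A \<subset> V \<Longrightarrow> 2 \<le> card A \<Longrightarrow> 2 * m + dist_mult (2 * m) (sum b A) \<le> boundary_degree V c p q A"
    and x: "x \<in> V" "2 * m dvd b x"
    and s: "s \<in> V" "s \<noteq> x" "c x s \<ge> 1" "p x \<ge> 1"
  shows "admissible m V (\<lambda>u v. c u v - edge x s u v) (\<lambda>v. p v - ind x v + ind s v) q b x"
proof (rule admissible_step[OF adm slack])
  have fV: "finite V" using adm by (simp add: admissible_def)
  note c = admissible_sym[OF adm] admissible_nonneg(1)[OF adm]
  have sump: "sum (\<lambda>v. p v - ind x v + ind s v) A = sum p A - of_bool (x \<in> A) + of_bool (s \<in> A)"
    if "A \<subseteq> V" for A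
    using that fV by (simp add: sum.distrib sum_subtractf sum_ind finite_subset)
  have deg: "boundary_degree V (\<lambda>u v. c u v - edge x s u v) (\<lambda>v. p v - ind x v + ind s v) q A
      = boundary_degree V c p q A - 2 * of_bool (x \<in> A \<and> s \<notin> A)" if "A \<subseteq> V" for A
    using that fV x(1) s(1) by (auto simp: boundary_degree_def cut_weight_diff cut_weight_edge sump)
  show "(\<Sum>v\<in>V. b v + (p v - ind x v + ind s v) - q v) = (\<Sum>v\<in>V. b v + p v - q v)"
    using fV x s by (simp add: sum.distrib sum_subtractf sum_ind)
  show "even (boundary_degree V (\<lambda>u v. c u v - edge x s u v) (\<lambda>v. p v - ind x v + ind s v) q A - boundary_degree V c p q A -
      (sum b A - sum b A))" if "A \<subseteq> V" for A
    unfolding deg[OF that] by simp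
  show "(\<Sum>v\<in>V. p v - ind x v + ind s v) + sum q V
      \<le> 2 * m - 2 + dist_mult (2 * m) ((\<Sum>v\<in>V. p v - ind x v + ind s v) - sum q V)"
    unfolding sump[OF subset_refl] using x(1) s(1) adm by (simp add: admissible_def)
  show "2 * m - 2 + dist_mult (2 * m) (b v)
      \<le> boundary_degree V (\<lambda>u v. c u v - edge x s u v) (\<lambda>v. p v - ind x v + ind s v) q {v}"
    if v: "v \<in> V" "V \<noteq> {v}" "\<not> (v = x \<and> 2 * m dvd b v)" for v
    using admissible_singleton[OF adm v] deg[of "{v}"] v x by auto
  show "boundary_degree V c p q A - 2 - dist_mult (2 * m) (sum b A)
      \<le> boundary_degree V (\<lambda>u v. c u v - edge x s u v) (\<lambda>v. p v - ind x v + ind s v) q A - dist_mult (2 * m) (sum b A)"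
    if "A \<subset> V" for A
    using deg[of A] that by auto
  show "c u v - edge x s u v = c v u - edge x s v u" for u v
    unfolding c(1)[of u v] edge_commute[of x s u v] ..
  show "0 \<le> c u v - edge x s u v" for u v
    using edge_le[of c x s u v] c s by simp
  show "0 \<le> p v - ind x v + ind s v" "0 \<le> q v" for v
    using admissible_nonneg[OF adm] s by (auto simp: ind_def)
qed

text \<open>The edges from \<open>x\<close> to \<open>s\<close> and to \<open>t\<close> become one
  edge between \<open>s\<close> and \<open>t\<close>. A cut loses 2 if it separates \<open>x\<close>
  from both \<open>s\<close> and \<open>t\<close>, and nothing otherwise. As \<open>s\<close> and
  \<open>t\<close> are distinct, no singleton other than the exempt \<open>{x}\<close> is
  affected.\<close>

lemma admissible_lift:
  assumes adm: "admissible m V c p q b x"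
    and slack: "\<And>A. A \<subset> V \<Longrightarrow> 2 \<le> card A \<Longrightarrow> 2 * m + dist_mult (2 * m) (sum b A) \<le> boundary_degree V c p q A"
    and x: "x \<in> V" "2 * m dvd b x"
    and st: "s \<in> V" "s \<noteq> x" "c x s \<ge> 1" "t \<in> V" "t \<noteq> x" "c x t \<ge> 1" "s \<noteq> t"
  shows "admissible m V (\<lambda>u v. c u v - edge x s u v - edge x t u v + edge s t u v) p q b x"
proof (rule admissible_step[OF adm slack])
  have fV: "finite V" using adm by (simp add: admissible_def)
  note c = admissible_sym[OF adm] admissible_nonneg(1)[OF adm]
  have deg: "boundary_degree V (\<lambda>u v. c u v - edge x s u v - edge x t u v + edge s t u v) p q A
      = boundary_degree V c p q A - 2 * of_bool ((x \<in> A) \<noteq> (s \<in> A) \<and> (x \<in> A) \<noteq> (t \<in> A))" if "A \<subseteq> V" for A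
    using that fV x(1) st(1,4) by (auto simp: boundary_degree_def cut_weight_diff cut_weight_add cut_weight_edge)
  show "even (boundary_degree V (\<lambda>u v. c u v - edge x s u v - edge x t u v + edge s t u v) p q A - boundary_degree V c p q A -
      (sum b A - sum b A))" if "A \<subseteq> V" for A
    unfolding deg[OF that] by simp
  show "2 * m - 2 + dist_mult (2 * m) (b v)
      \<le> boundary_degree V (\<lambda>u v. c u v - edge x s u v - edge x t u v + edge s t u v) p q {v}"
    if v: "v \<in> V" "V \<noteq> {v}" "\<not> (v = x \<and> 2 * m dvd b v)" for v
    using admissible_singleton[OF adm v] deg[of "{v}"] v x st by auto
  show "boundary_degree V c p q A - 2 - dist_mult (2 * m) (sum b A)
      \<le> boundary_degree V (\<lambda>u v. c u v - edge x s u v - edge x t u v + edge s t u v) p q A - dist_mult (2 * m) (sum b A)"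
    if "A \<subset> V" for A
    using deg[of A] that by auto
  show "c u v - edge x s u v - edge x t u v + edge s t u v
      = c v u - edge x s v u - edge x t v u + edge s t v u" for u v
    unfolding c(1)[of u v] edge_commute[of x s u v] edge_commute[of x t u v] edge_commute[of s t u v] ..
  show "0 \<le> c u v - edge x s u v - edge x t u v + edge s t u v" for u v
  proof -
    have "edge x s u v = 0 \<or> edge x t u v = 0" using st by (auto simp: edge_def arc_def)
    moreover have "0 \<le> edge s t u v" by (simp add: edge_def arc_def)
    ultimately show ?thesis
      using edge_le[of c x s u v] edge_le[of c x t u v] c(2)[of u v] c st by auto
  qed
qed (use adm in \<open>simp_all add: admissible_def\<close>)

text \<open>The lifted graph has at least one edge between \<open>s\<close> and \<open>t\<close>,
  hence one directed from \<open>s\<close> to \<open>t\<close> or one from \<open>t\<close> to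
  \<open>s\<close>. Rerouting it through \<open>x\<close> leaves the net outflow of every vertex
  unchanged.\<close>

lemma solution_lift:
  assumes fV: "finite V" and x: "x \<in> V"
    and st: "s \<in> V" "s \<noteq> x" "c x s \<ge> 1" "t \<in> V" "t \<noteq> x" "c x t \<ge> 1" "s \<noteq> t"
    and sol: "solution m V (\<lambda>u v. c u v - edge x s u v - edge x t u v + edge s t u v) p q b f"
    and c: "\<And>u v. c u v = c v u" "\<And>u v. 0 \<le> c u v"
  shows "\<exists>f. solution m V c p q b f"
proof -
  have *: "solution m V c p q b (\<lambda>u v. f u v - arc s t u v + arc s x u v + arc x t u v)"
    if st: "s \<in> V" "s \<noteq> x" "t \<in> V" "t \<noteq> x" "s \<noteq> t" "f s t \<ge> 1"
      and sol: "solution m V (\<lambda>u v. c u v - edge x s u v - edge x t u v + edge s t u v) p q b f" for s t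
    unfolding solution_def
  proof (intro conjI ballI impI)
    fix u v assume uv: "u \<in> V" "v \<in> V" "u \<noteq> v"
    note uv' = solutionD(1,2)[OF sol uv]
    have "arc s t u v \<le> f u v" using uv'(1) st(6) by (cases "u = s \<and> v = t") (auto simp: arc_def)
    then show "0 \<le> f u v - arc s t u v + arc s x u v + arc x t u v"
      using arc_nonneg[of s x u v] arc_nonneg[of x t u v] by linarith
    show "f u v - arc s t u v + arc s x u v + arc x t u v +
       (f v u - arc s t v u + arc s x v u + arc x t v u) = c u v"
      using uv'(2) arc_swap[of x s u v] arc_swap[of s x u v] arc_swap[of t x u v]
        arc_swap[of x t v u] arc_swap[of t s u v] unfolding edge_def by linarith
  next
    fix v assume "v \<in> V"
    have "net V (\<lambda>u v. f u v - arc s t u v + arc s x u v + arc x t u v) v = net V f v"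
      using fV x st by (simp add: net_add net_diff net_arc)
    then show "2 * m dvd net V (\<lambda>u v. f u v - arc s t u v + arc s x u v + arc x t u v) v - (b v + p v - q v)"
      using solutionD(3)[OF sol \<open>v \<in> V\<close>] by simp
  qed
  have "0 \<le> c s t" using c by blast
  moreover have "0 \<le> f s t" "0 \<le> f t s" using solutionD(1)[OF sol] st by auto
  moreover have "edge x s s t = 0" "edge x t s t = 0" "edge s t s t = 1"
    using st by (auto simp: edge_def arc_def)
  then have "f s t + f t s = c s t + 1" using solutionD(2)[OF sol, of s t] st by simp
  ultimately consider "f s t \<ge> 1" | "f t s \<ge> 1" by linarith
  then show ?thesis
  proof cases
    case 1 then show ?thesis using *[of s t] st sol by blast
  next
    case 2
    have "edge s t = edge t s" by (auto simp: edge_def fun_eq_iff)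
    then have "solution m V (\<lambda>u v. c u v - edge x t u v - edge x s u v + edge t s u v) p q b f"
      using sol by (simp add: algebra_simps)
    then show ?thesis using *[of t s] st 2 by blast
  qed
qed

section \<open>Deleting a vertex of zero demand with a single neighbour\<close>

lemma admissible_finite: "admissible m V c p q b x0 \<Longrightarrow> finite V"
  by (simp add: admissible_def)

lemma admissible_total:
  "admissible m V c p q b x0 \<Longrightarrow> 2 * m dvd (\<Sum>v\<in>V. b v + p v - q v)"
  by (simp add: admissible_def)

lemma admissible_even:
  assumes "admissible m V c p q b x0" "A \<subseteq> V"
  shows "even (boundary_degree V c p q A - sum b A)"
proof -
  have "\<forall>A\<subseteq>V. even (boundary_degree V c p q A - sum b A)"
    using assms(1) unfolding admissible_def by (elim conjE)
  then show ?thesis using assms(2) by blast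
qed

lemma admissible_root:
  "admissible m V c p q b x0 \<Longrightarrow>
    sum p V + sum q V \<le> 2 * m - 2 + dist_mult (2 * m) (sum p V - sum q V)"
  by (simp add: admissible_def)

lemma admissible_cut:
  assumes "admissible m V c p q b x0" "A \<noteq> {}" "A \<subset> V" "\<not> (A = {x0} \<and> 2 * m dvd b x0)"
  shows "2 * m - 2 + dist_mult (2 * m) (sum b A) \<le> boundary_degree V c p q A"
proof -
  have "\<forall>A. A \<noteq> {} \<and> A \<subset> V \<and> \<not> (A = {x0} \<and> 2 * m dvd b x0) \<longrightarrow>
      2 * m - 2 + dist_mult (2 * m) (sum b A) \<le> boundary_degree V c p q A"
    using assms(1) unfolding admissible_def by (elim conjE)
  then show ?thesis using assms(2-4) by blast
qed

text \<open>All edges at \<open>x\<close> go to \<open>s\<close>, so none of them is cut once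
  \<open>x\<close> is put on the side of \<open>s\<close>.\<close>

lemma cut_weight_delete:
  assumes fV: "finite V" and sym: "\<And>u v. c u v = c v u" and x: "x \<in> V" "s \<in> V" "s \<noteq> x"
    and only: "\<And>u. u \<in> V \<Longrightarrow> u \<noteq> x \<Longrightarrow> u \<noteq> s \<Longrightarrow> c x u = 0"
    and A: "A \<subseteq> V - {x}"
  shows "cut_weight (V - {x}) c A = cut_weight V c (if s \<in> A then insert x A else A)"
proof (cases "s \<in> A")
  case True
  have "finite A" "x \<notin> A" using A fV finite_subset by auto
  have "(\<Sum>u\<in>V - insert x A. c x u) = 0"
    using True only by (intro sum.neutral) auto
  moreover have "V - {x} - A = V - insert x A" by auto
  ultimately show ?thesis using True \<open>finite A\<close> \<open>x \<notin> A\<close> by (simp add: cut_weight_def)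
next
  case False
  have "cut_weight (V - {x}) c A = (\<Sum>a\<in>A. \<Sum>u\<in>V - A. c a u)"
    unfolding cut_weight_def
  proof (rule sum.cong[OF refl])
    fix a assume "a \<in> A"
    then have "c x a = 0" using A False by (intro only) auto
    then have "c a x = 0" using sym[of a x] by linarith
    moreover have "V - A = insert x (V - {x} - A)" using A x by auto
    ultimately show "(\<Sum>u\<in>V - {x} - A. c a u) = (\<Sum>u\<in>V - A. c a u)"
      using fV by simp
  qed
  then show ?thesis using False by (simp add: cut_weight_def)
qed

text \<open>The condition on \<open>A\<close> in the smaller graph is the condition on
  \<open>up A\<close> in the larger one: putting \<open>x\<close> on the side of its only neighbour
  changes neither the degree nor, modulo \<open>2 * m\<close>, the demand.\<close>

lemma admissible_delete:
  assumes adm: "admissible m V c p q b x"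
    and slack: "\<And>A. A \<subset> V \<Longrightarrow> 2 \<le> card A \<Longrightarrow> 2 * m + dist_mult (2 * m) (sum b A) \<le> boundary_degree V c p q A"
    and x: "x \<in> V" "2 * m dvd b x" "p x = 0" "q x = 0"
    and s: "s \<in> V" "s \<noteq> x"
    and only: "\<And>u. u \<in> V \<Longrightarrow> u \<noteq> x \<Longrightarrow> u \<noteq> s \<Longrightarrow> c x u = 0"
  shows "admissible m (V - {x}) c p q b x"
proof -
  have fV: "finite V" using adm by (rule admissible_finite)
  define up where "up A = (if s \<in> A then insert x A else A)" for A
  have up: "boundary_degree (V - {x}) c p q A = boundary_degree V c p q (up A)" if "A \<subseteq> V - {x}" for A
  proof -
    have "finite A" "x \<notin> A" using that fV finite_subset by auto
    then show ?thesis
      using cut_weight_delete[of V c x s A, OF fV admissible_sym[OF adm] x(1) s only that] x(3,4)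
      by (simp add: boundary_degree_def up_def)
  qed
  have sumb: "2 * m dvd sum b (up A) - sum b A" if "A \<subseteq> V - {x}" for A
  proof -
    have "finite A" "x \<notin> A" using that fV finite_subset by auto
    then show ?thesis using x(2) by (simp add: up_def)
  qed
  have sub: "sum h V = sum h (V - {x}) + h x" for h :: "'a \<Rightarrow> int"
    using fV x(1) by (simp add: sum.remove)
  show ?thesis unfolding admissible_def
  proof (intro conjI)
    show "finite (V - {x})" using fV by simp
    show "\<forall>u v. c u v = c v u \<and> 0 \<le> c u v" by (rule admissible_graph[OF adm, THEN conjunct1])
    show "\<forall>v. 0 \<le> p v \<and> 0 \<le> q v" by (rule admissible_graph[OF adm, THEN conjunct2])
    have "2 * m dvd (\<Sum>v\<in>V - {x}. b v + p v - q v) + b x"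
      using admissible_total[OF adm] x(3,4) by (simp add: sub)
    then show "2 * m dvd (\<Sum>v\<in>V - {x}. b v + p v - q v)"
      using x(2) by (simp add: dvd_add_left_iff)
    show "sum p (V - {x}) + sum q (V - {x}) \<le> 2 * m - 2 + dist_mult (2 * m) (sum p (V - {x}) - sum q (V - {x}))"
      using admissible_root[OF adm] x(3,4) by (simp add: sub)
    show "\<forall>A\<subseteq>V - {x}. even (boundary_degree (V - {x}) c p q A - sum b A)"
    proof (intro allI impI)
      fix A assume A: "A \<subseteq> V - {x}"
      then have "up A \<subseteq> V" using x(1) by (auto simp: up_def)
      then have "even (boundary_degree V c p q (up A) - sum b (up A))" by (rule admissible_even[OF adm])
      moreover have "even (sum b (up A) - sum b A)" using sumb[OF A] by (rule dvd_mult_left)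
      ultimately have "even ((boundary_degree V c p q (up A) - sum b (up A)) + (sum b (up A) - sum b A))"
        by (rule dvd_add)
      then show "even (boundary_degree (V - {x}) c p q A - sum b A)" unfolding up[OF A] by simp
    qed
    show "\<forall>A. A \<noteq> {} \<and> A \<subset> V - {x} \<and> \<not> (A = {x} \<and> 2 * m dvd b x) \<longrightarrow>
        2 * m - 2 + dist_mult (2 * m) (sum b A) \<le> boundary_degree (V - {x}) c p q A"
    proof (intro allI impI)
      fix A assume "A \<noteq> {} \<and> A \<subset> V - {x} \<and> \<not> (A = {x} \<and> 2 * m dvd b x)"
      then have A: "A \<noteq> {}" "A \<subset> V - {x}" by auto
      \<comment> \<open>\<open>up A\<close> contains \<open>x\<close> only together with
        \<open>s\<close>, so it is never the exempt set; and in the smaller graph no nonempty set is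
        exempt, since \<open>x\<close> is gone.\<close>
      then have "up A \<noteq> {}" "up A \<subset> V" "up A \<noteq> {x}" using x(1) by (auto simp: up_def)
      then have "2 * m - 2 + dist_mult (2 * m) (sum b (up A)) \<le> boundary_degree V c p q (up A)"
        by (intro admissible_cut[OF adm]) auto
      moreover have "dist_mult (2 * m) (sum b (up A)) = dist_mult (2 * m) (sum b A)"
        using A by (intro dist_mult_cong sumb) auto
      ultimately show "2 * m - 2 + dist_mult (2 * m) (sum b A) \<le> boundary_degree (V - {x}) c p q A"
        using up[of A] A(2) by auto
    qed
  qed
qed

text \<open>The demand of \<open>x\<close> is even, so by parity the number of edges between
  \<open>x\<close> and \<open>s\<close> is even. Directing half of them each way contributes 0 at
  both ends.\<close>

lemma solution_delete:
  assumes adm: "admissible m V c p q b x"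
    and x: "x \<in> V" "2 * m dvd b x" "p x = 0" "q x = 0"
    and s: "s \<in> V" "s \<noteq> x"
    and only: "\<And>u. u \<in> V \<Longrightarrow> u \<noteq> x \<Longrightarrow> u \<noteq> s \<Longrightarrow> c x u = 0"
    and sol: "solution m (V - {x}) c p q b f"
  shows "solution m V c p q b (\<lambda>u v. if u = x \<or> v = x then c u v div 2 else f u v)"
    (is "solution m V c p q b ?f")
proof -
  note sym = admissible_sym[OF adm]
  have fV: "finite V" using adm by (rule admissible_finite)
  have "cut_weight V c {x} = c x s"
  proof -
    have "cut_weight V c {x} = (\<Sum>u\<in>V - {x}. c x u)" by (simp add: cut_weight_def)
    also have "\<dots> = (\<Sum>u\<in>{s}. c x u)"
      using fV s only by (intro sum.mono_neutral_right) auto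
    finally show ?thesis by simp
  qed
  then have "even (c x s - b x)"
    using admissible_even[OF adm, of "{x}"] x by (simp add: boundary_degree_def)
  moreover have "even (b x)" using x(2) by (rule dvd_mult_left)
  ultimately have "even (c x s)" by simp
  then have ev: "even (c x u)" if "u \<in> V" "u \<noteq> x" for u
    using only[OF that] by (cases "u = s") auto
  have netf: "net V ?f v = net (V - {x}) f v" if "v \<in> V - {x}" for v
  proof -
    have "net V ?f v = (\<Sum>u\<in>V - {x}. ?f v u - ?f u v) + (?f v x - ?f x v)"
      using fV x(1) by (simp add: net_def sum.remove[of V x])
    also have "(\<Sum>u\<in>V - {x}. ?f v u - ?f u v) = net (V - {x}) f v"
      unfolding net_def using that by (intro sum.cong) auto
    also have "?f v x - ?f x v = 0" using sym[of v x] by simp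
    finally show ?thesis by simp
  qed
  have "net V ?f x = 0" unfolding net_def
    by (rule sum.neutral) (use sym in simp)
  then have "2 * m dvd net V ?f v - (b v + p v - q v)" if "v \<in> V" for v
    using netf[of v] solutionD(3)[OF sol, of v] x that by (cases "v = x") auto
  moreover have "0 \<le> ?f u v \<and> ?f u v + ?f v u = c u v" if "u \<in> V" "v \<in> V" "u \<noteq> v" for u v
  proof (cases "u = x \<or> v = x")
    case True
    have "c u v = c v u" "0 \<le> c u v" using sym admissible_nonneg[OF adm] by auto
    moreover have "even (c u v)" using True ev[of v] ev[of u] that sym[of u v] by auto
    ultimately show ?thesis using True by (auto elim!: evenE)
  next
    case False
    then show ?thesis using solutionD(1,2)[OF sol, of u v] that by auto
  qed
  ultimately show ?thesis unfolding solution_def by blast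
qed

subsection \<open>Contracting a tight set\<close>

lemma sum_blocks:
  assumes "finite B" "\<And>v. v \<in> B \<Longrightarrow> finite (block v)"
    and "\<And>u v. u \<in> B \<Longrightarrow> v \<in> B \<Longrightarrow> u \<noteq> v \<Longrightarrow> block u \<inter> block v = {}"
  shows "(\<Sum>v\<in>B. sum g (block v)) = sum g (\<Union>v\<in>B. block v)"
  using assms by (subst sum.UNION_disjoint) auto

lemma cut_weight_quotient:
  fixes c :: "'a \<Rightarrow> 'a \<Rightarrow> int"
  assumes fin: "finite V1" "\<And>v. v \<in> V1 \<Longrightarrow> finite (block v)"
    and dj: "\<And>u v. u \<in> V1 \<Longrightarrow> v \<in> V1 \<Longrightarrow> u \<noteq> v \<Longrightarrow> block u \<inter> block v = {}"
    and B: "B \<subseteq> V1"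
  shows "cut_weight V1 (\<lambda>u v. if u = v then 0 else \<Sum>a\<in>block u. \<Sum>e\<in>block v. c a e) B
    = cut_weight (\<Union>v\<in>V1. block v) c (\<Union>v\<in>B. block v)"
proof -
  have rest: "(\<Union>v\<in>V1. block v) - (\<Union>v\<in>B. block v) = (\<Union>v\<in>V1 - B. block v)"
    using dj B by fastforce
  have fB: "finite B" using fin(1) B by (rule rev_finite_subset)
  have "cut_weight V1 (\<lambda>u v. if u = v then 0 else \<Sum>a\<in>block u. \<Sum>e\<in>block v. c a e) B
      = (\<Sum>v\<in>B. \<Sum>u\<in>V1 - B. \<Sum>a\<in>block v. \<Sum>e\<in>block u. c a e)"
    unfolding cut_weight_def by (intro sum.cong refl) auto
  also have "\<dots> = (\<Sum>v\<in>B. \<Sum>a\<in>block v. \<Sum>u\<in>V1 - B. \<Sum>e\<in>block u. c a e)"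
    by (intro sum.cong refl sum.swap)
  also have "\<dots> = (\<Sum>v\<in>B. \<Sum>a\<in>block v. sum (c a) (\<Union>u\<in>V1 - B. block u))"
    using fin dj by (intro sum.cong refl sum_blocks) auto
  also have "\<dots> = (\<Sum>a\<in>(\<Union>v\<in>B. block v). sum (c a) (\<Union>u\<in>V1 - B. block u))"
    using fB fin(2) dj B by (intro sum_blocks) auto
  finally show ?thesis unfolding cut_weight_def rest .
qed

text \<open>Greedy filling: \<open>x\<close> takes \<open>min t (cap x)\<close> and the rest is
  distributed over \<open>A\<close>. This is what spreads the arcs into a contracted vertex over the
  vertices that it stands for.\<close>

lemma split_int:
  fixes cap :: "'a \<Rightarrow> int"
  assumes "finite A" "\<And>a. a \<in> A \<Longrightarrow> 0 \<le> cap a" "0 \<le> t" "t \<le> sum cap A"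
  shows "\<exists>g. (\<forall>a\<in>A. 0 \<le> g a \<and> g a \<le> cap a) \<and> (\<forall>a. a \<notin> A \<longrightarrow> g a = 0) \<and> sum g A = t"
  using assms
proof (induction A arbitrary: t rule: finite_induct)
  case empty
  then show ?case by (intro exI[of _ "\<lambda>_. 0"]) auto
next
  case (insert x A)
  define s where "s = min t (cap x)"
  have "0 \<le> cap x" using insert by simp
  moreover have "0 \<le> sum cap A" using insert.prems(1) by (intro sum_nonneg) simp
  moreover have "0 \<le> t" "t \<le> cap x + sum cap A" using insert by simp_all
  ultimately have "0 \<le> t - s" "t - s \<le> sum cap A" "0 \<le> s" "s \<le> cap x"
    unfolding s_def by linarith+
  then obtain g where g: "\<forall>a\<in>A. 0 \<le> g a \<and> g a \<le> cap a" "\<forall>a. a \<notin> A \<longrightarrow> g a = 0" "sum g A = t - s"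
    using insert.IH[of "t - s"] insert.prems by auto
  have "sum (g(x := s)) (insert x A) = s + sum (g(x := s)) A"
    using insert by simp
  also have "sum (g(x := s)) A = sum g A"
    using insert by (intro sum.cong) auto
  finally show ?case
    using g \<open>0 \<le> s\<close> \<open>s \<le> cap x\<close> by (intro exI[of _ "g(x := s)"]) auto
qed

context
  fixes m :: int and V A :: "'a set" and c :: "'a \<Rightarrow> 'a \<Rightarrow> int" and p q b :: "'a \<Rightarrow> int" and x0 r :: 'a
  assumes adm: "admissible m V c p q b x0"
    and A: "A \<subset> V" "2 \<le> card A" "r \<in> A"
begin

text \<open>The contracted set is represented by one of its own elements \<open>r\<close>, so that
  the quotient has vertices of the same type and the induction hypothesis applies to it.\<close>

definition "block v = (if v = r then A else {v})"
definition "quot_verts = insert r (V - A)"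
text \<open>Edges inside \<open>A\<close> would become loops at \<open>r\<close>; the zero diagonal
  discards them.\<close>

definition "quot_weight u v = (if u = v then 0 else \<Sum>a\<in>block u. \<Sum>e\<in>block v. c a e)"
definition "quot_sum (h :: 'a \<Rightarrow> int) v = sum h (block v)"

lemma finVA: "finite V" "finite A" "finite quot_verts" "finite (block v)"
  using admissible_finite[OF adm] A finite_subset by (auto simp: quot_verts_def block_def)

lemma block_disjoint: "u \<in> quot_verts \<Longrightarrow> v \<in> quot_verts \<Longrightarrow> u \<noteq> v \<Longrightarrow> block u \<inter> block v = {}"
  by (auto simp: quot_verts_def block_def)

lemma block_union: "(\<Union>v\<in>quot_verts. block v) = V"
  using A by (auto simp: quot_verts_def block_def)

lemma sum_quot_sum:
  assumes "B \<subseteq> quot_verts"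
  shows "sum (quot_sum h) B = sum h (\<Union>v\<in>B. block v)"
  unfolding quot_sum_def
proof (rule sum_blocks)
  show "finite B" using assms finVA(3) by (rule finite_subset)
  show "block u \<inter> block v = {}" if "u \<in> B" "v \<in> B" "u \<noteq> v" for u v
    using assms that by (intro block_disjoint) auto
qed (rule finVA)

lemma boundary_degree_quotient:
  assumes "B \<subseteq> quot_verts"
  shows "boundary_degree quot_verts quot_weight (quot_sum p) (quot_sum q) B = boundary_degree V c p q (\<Union>v\<in>B. block v)"
proof -
  have "quot_weight = (\<lambda>u v. if u = v then 0 else \<Sum>a\<in>block u. \<Sum>e\<in>block v. c a e)"
    by (simp add: fun_eq_iff quot_weight_def)
  then have "cut_weight quot_verts quot_weight B = cut_weight (\<Union>v\<in>quot_verts. block v) c (\<Union>v\<in>B. block v)"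
    using cut_weight_quotient[of quot_verts block B c, OF finVA(3,4) block_disjoint assms] by simp
  then show ?thesis unfolding boundary_degree_def sum_quot_sum[OF assms] block_union by simp
qed

text \<open>Each condition on \<open>B\<close> is the one on the union of its blocks. Care is needed
  only with the exemption: as \<open>block r\<close> has at least two elements, that union is
  \<open>{x0}\<close> only if \<open>B = {x0}\<close> and \<open>x0\<close> is different from
  \<open>r\<close>, and then the demand of \<open>x0\<close> is unchanged.\<close>

lemma admissible_quotient: "admissible m quot_verts quot_weight (quot_sum p) (quot_sum q) (quot_sum b) x0"
  unfolding admissible_def
proof (intro conjI)
  show "finite quot_verts" by (rule finVA)
  have "quot_weight u v = quot_weight v u" for u v
  proof -
    have "(\<Sum>a\<in>block u. \<Sum>e\<in>block v. c a e) = (\<Sum>e\<in>block v. \<Sum>a\<in>block u. c a e)" by (rule sum.swap)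
    also have "\<dots> = (\<Sum>e\<in>block v. \<Sum>a\<in>block u. c e a)"
      by (intro sum.cong refl admissible_sym[OF adm])
    finally show ?thesis by (simp add: quot_weight_def)
  qed
  moreover have "0 \<le> quot_weight u v" for u v
    using admissible_nonneg(1)[OF adm] by (auto simp: quot_weight_def intro!: sum_nonneg)
  ultimately show "\<forall>u v. quot_weight u v = quot_weight v u \<and> 0 \<le> quot_weight u v" by blast
  show "\<forall>v. 0 \<le> quot_sum p v \<and> 0 \<le> quot_sum q v"
    using admissible_nonneg(2,3)[OF adm] by (auto simp: quot_sum_def intro!: sum_nonneg)
  have all: "sum (quot_sum h) quot_verts = sum h V" for h
    using sum_quot_sum[OF subset_refl] by (simp add: block_union)
  have "(\<Sum>v\<in>quot_verts. quot_sum b v + quot_sum p v - quot_sum q v) = (\<Sum>v\<in>V. b v + p v - q v)"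
    by (simp add: sum.distrib sum_subtractf all)
  then show "2 * m dvd (\<Sum>v\<in>quot_verts. quot_sum b v + quot_sum p v - quot_sum q v)"
    using admissible_total[OF adm] by simp
  show "sum (quot_sum p) quot_verts + sum (quot_sum q) quot_verts \<le> 2 * m - 2 + dist_mult (2 * m) (sum (quot_sum p) quot_verts - sum (quot_sum q) quot_verts)"
    unfolding all by (rule admissible_root[OF adm])
  show "\<forall>B\<subseteq>quot_verts. even (boundary_degree quot_verts quot_weight (quot_sum p) (quot_sum q) B - sum (quot_sum b) B)"
  proof (intro allI impI)
    fix B assume B: "B \<subseteq> quot_verts"
    then have "(\<Union>v\<in>B. block v) \<subseteq> V" using block_union by blast
    then show "even (boundary_degree quot_verts quot_weight (quot_sum p) (quot_sum q) B - sum (quot_sum b) B)"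
      unfolding boundary_degree_quotient[OF B] sum_quot_sum[OF B] by (rule admissible_even[OF adm])
  qed
  show "\<forall>B. B \<noteq> {} \<and> B \<subset> quot_verts \<and> \<not> (B = {x0} \<and> 2 * m dvd quot_sum b x0) \<longrightarrow>
      2 * m - 2 + dist_mult (2 * m) (sum (quot_sum b) B) \<le> boundary_degree quot_verts quot_weight (quot_sum p) (quot_sum q) B"
  proof (intro allI impI)
    fix B assume B: "B \<noteq> {} \<and> B \<subset> quot_verts \<and> \<not> (B = {x0} \<and> 2 * m dvd quot_sum b x0)"
    have ne: "block v \<noteq> {}" for v using A by (auto simp: block_def)
    obtain w where w: "w \<in> quot_verts" "w \<notin> B" using B by blast
    have "block w \<inter> (\<Union>v\<in>B. block v) = {}" using w B block_disjoint by blast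
    moreover have "block w \<subseteq> V" using w block_union by blast
    ultimately have "(\<Union>v\<in>B. block v) \<subset> V" using ne[of w] B block_union by blast
    moreover have "(\<Union>v\<in>B. block v) \<noteq> {}" using B ne by blast
    moreover have "\<not> ((\<Union>v\<in>B. block v) = {x0} \<and> 2 * m dvd b x0)"
    proof
      assume *: "(\<Union>v\<in>B. block v) = {x0} \<and> 2 * m dvd b x0"
      have "block v = {x0}" if "v \<in> B" for v
      proof -
        have "block v \<subseteq> (\<Union>v\<in>B. block v)" using that by blast
        then show ?thesis using * ne[of v] by (simp add: subset_singleton_iff)
      qed
      moreover have "block v = {x0} \<longleftrightarrow> v = x0 \<and> x0 \<noteq> r" for v using A(2) by (auto simp: block_def)
      ultimately have "\<forall>v\<in>B. v = x0 \<and> x0 \<noteq> r" by blast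
      moreover have "B \<noteq> {}" using B by blast
      ultimately have "B = {x0}" "x0 \<noteq> r" by auto
      moreover have "quot_sum b x0 = b x0" using \<open>x0 \<noteq> r\<close> by (simp add: quot_sum_def block_def)
      ultimately show False using B * by simp
    qed
    ultimately have "2 * m - 2 + dist_mult (2 * m) (sum b (\<Union>v\<in>B. block v)) \<le> boundary_degree V c p q (\<Union>v\<in>B. block v)"
      by (intro admissible_cut[OF adm])
    then show "2 * m - 2 + dist_mult (2 * m) (sum (quot_sum b) B) \<le> boundary_degree quot_verts quot_weight (quot_sum p) (quot_sum q) B"
      using boundary_degree_quotient[of B] sum_quot_sum[of B] B by auto
  qed
qed

lemma card_quot_verts: "card quot_verts < card V"
proof -
  have "card quot_verts = Suc (card V - card A)"
    using finVA A by (simp add: quot_verts_def card_Diff_subset psubset_imp_subset)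
  moreover have "card A < card V" using finVA A by (simp add: psubset_card_mono)
  ultimately show ?thesis using A(2) by linarith
qed

text \<open>
  The solution of the contracted graph fixes the direction of the edges leaving \<open>A\<close>; the inside of \<open>A\<close>
  is then solved with everything outside \<open>A\<close> as the root, whose degree is small because \<open>A\<close> is tight.\<close>

lemma solution_contract:
  assumes m: "m > 0"
    and tight: "boundary_degree V c p q A \<le> 2 * m - 2 + dist_mult (2 * m) (sum b A)"
    and outer: "solution m quot_verts quot_weight (quot_sum p) (quot_sum q) (quot_sum b) f1"
    and inner: "\<And>p' q'. admissible m A c p' q' b x0 \<Longrightarrow> \<exists>f. solution m A c p' q' b f"
  shows "\<exists>f. solution m V c p q b f"
proof -
  define U where "U = V - A"
  have finU: "finite U" using finVA by (simp add: U_def)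
  have UV: "u \<in> quot_verts" "u \<noteq> r" if "u \<in> U" for u using that A by (auto simp: U_def quot_verts_def)
  have rV: "r \<in> quot_verts" by (simp add: quot_verts_def)
  have cq_r: "quot_weight u r = (\<Sum>a\<in>A. c u a)" if "u \<in> U" for u
    using UV[OF that] by (simp add: quot_weight_def block_def)
  have cq_U: "quot_weight u v = c u v" if "u \<in> U" "v \<in> U" "u \<noteq> v" for u v
    using UV[OF that(1)] UV[OF that(2)] that(3) by (simp add: quot_weight_def block_def)
  have f1: "0 \<le> f1 u r" "0 \<le> f1 r u" "f1 u r + f1 r u = (\<Sum>a\<in>A. c u a)" if "u \<in> U" for u
    using solutionD(1)[OF outer, of u r] solutionD(1)[OF outer, of r u]
      solutionD(2)[OF outer, of u r] UV[OF that] rV cq_r[OF that] by auto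
  \<comment> \<open>For every outer vertex \<open>u\<close>, the \<open>f1 u r\<close> arcs into the
    contracted vertex are distributed over \<open>A\<close>, within the number of edges present:
    \<open>g u a\<close> edges are directed from \<open>u\<close> to \<open>a\<close>.\<close>
  have "\<forall>u\<in>U. \<exists>h. (\<forall>a\<in>A. 0 \<le> h a \<and> h a \<le> c u a) \<and> (\<forall>a. a \<notin> A \<longrightarrow> h a = 0) \<and> sum h A = f1 u r"
  proof
    fix u assume "u \<in> U"
    show "\<exists>h. (\<forall>a\<in>A. 0 \<le> h a \<and> h a \<le> c u a) \<and> (\<forall>a. a \<notin> A \<longrightarrow> h a = 0) \<and> sum h A = f1 u r"
      using f1[OF \<open>u \<in> U\<close>] admissible_nonneg(1)[OF adm] finVA(2) by (intro split_int) auto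
  qed
  from bchoice[OF this] obtain g where g: "\<forall>u\<in>U. (\<forall>a\<in>A. 0 \<le> g u a \<and> g u a \<le> c u a) \<and>
      (\<forall>a. a \<notin> A \<longrightarrow> g u a = 0) \<and> sum (g u) A = f1 u r" by blast
  have g0: "0 \<le> g u a" "g u a \<le> c u a" if "u \<in> U" for u a
  proof -
    have "0 \<le> g u a \<and> g u a \<le> c u a"
      using g that admissible_nonneg(1)[OF adm, of u a] by (cases "a \<in> A") auto
    then show "0 \<le> g u a" "g u a \<le> c u a" by auto
  qed
  have gsum: "sum (g u) A = f1 u r" if "u \<in> U" for u using g that by blast
  \<comment> \<open>For the inner graph all of \<open>U\<close> is merged into the root, so the
    edges between \<open>U\<close> and \<open>A\<close>, now directed, join the root edges.\<close>
  define p2 where "p2 a = p a + (\<Sum>u\<in>U. g u a)" for a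
  define q2 where "q2 a = q a + (\<Sum>u\<in>U. c u a - g u a)" for a
  have pq2: "sum p2 B + sum q2 B = sum p B + sum q B + (\<Sum>a\<in>B. \<Sum>u\<in>U. c u a)" for B
    unfolding p2_def q2_def sum.distrib[symmetric] by (rule sum.cong) (simp_all add: sum_subtractf)
  have bdeg2: "boundary_degree A c p2 q2 B = boundary_degree V c p q B" if "B \<subseteq> A" for B
  proof -
    have "V - B = (A - B) \<union> U" "(A - B) \<inter> U = {}" using that A by (auto simp: U_def)
    then have "cut_weight V c B = (\<Sum>a\<in>B. (\<Sum>u\<in>A - B. c a u) + (\<Sum>u\<in>U. c a u))"
      using finVA finU by (simp add: cut_weight_def sum.union_disjoint)
    also have "\<dots> = cut_weight A c B + (\<Sum>a\<in>B. \<Sum>u\<in>U. c a u)" by (simp add: cut_weight_def sum.distrib)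
    also have "(\<Sum>a\<in>B. \<Sum>u\<in>U. c a u) = (\<Sum>a\<in>B. \<Sum>u\<in>U. c u a)"
      by (intro sum.cong refl admissible_sym[OF adm])
    finally show ?thesis using pq2[of B] by (simp add: boundary_degree_def)
  qed
  have sp2: "sum p2 A = sum p A + (\<Sum>u\<in>U. f1 u r)"
  proof -
    have "(\<Sum>a\<in>A. \<Sum>u\<in>U. g u a) = (\<Sum>u\<in>U. sum (g u) A)" by (rule sum.swap)
    then show ?thesis using gsum by (simp add: p2_def sum.distrib)
  qed
  have sq2: "sum q2 A = sum q A + (\<Sum>u\<in>U. f1 r u)"
  proof -
    have "(\<Sum>a\<in>A. \<Sum>u\<in>U. c u a - g u a) = (\<Sum>u\<in>U. \<Sum>a\<in>A. c u a - g u a)" by (rule sum.swap)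
    also have "\<dots> = (\<Sum>u\<in>U. f1 r u)"
    proof (rule sum.cong[OF refl])
      fix u assume "u \<in> U"
      then show "(\<Sum>a\<in>A. c u a - g u a) = f1 r u"
        using gsum[of u] f1(3)[of u] by (simp add: sum_subtractf)
    qed
    finally show ?thesis by (simp add: q2_def sum.distrib)
  qed
  have "net quot_verts f1 r = (\<Sum>u\<in>U. f1 r u - f1 u r)"
    using finU A(3) by (simp add: net_def quot_verts_def U_def)
  then have net_r: "net quot_verts f1 r = (\<Sum>u\<in>U. f1 r u) - (\<Sum>u\<in>U. f1 u r)"
    by (simp add: sum_subtractf)
  have "2 * m dvd net quot_verts f1 r - (sum b A + sum p A - sum q A)"
    using solutionD(3)[OF outer rV] by (simp add: quot_sum_def block_def)
  then have "2 * m dvd - (net quot_verts f1 r - (sum b A + sum p A - sum q A))" by (simp only: dvd_minus_iff)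
  moreover have "- (net quot_verts f1 r - (sum b A + sum p A - sum q A)) = sum b A + sum p2 A - sum q2 A"
    using net_r sp2 sq2 by linarith
  ultimately have tot2: "2 * m dvd sum b A + sum p2 A - sum q2 A" by (simp only:)
  have "admissible m A c p2 q2 b x0"
    unfolding admissible_def
  proof (intro conjI)
    show "finite A" by (rule finVA)
    show "\<forall>u v. c u v = c v u \<and> 0 \<le> c u v" by (rule admissible_graph[OF adm, THEN conjunct1])
    show "\<forall>v. 0 \<le> p2 v \<and> 0 \<le> q2 v"
      using g0 admissible_nonneg(2,3)[OF adm] by (auto simp: p2_def q2_def intro!: add_nonneg_nonneg sum_nonneg)
    show "2 * m dvd (\<Sum>v\<in>A. b v + p2 v - q2 v)"
      using tot2 by (simp add: sum.distrib sum_subtractf)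
    \<comment> \<open>The imbalance of the new root is congruent to minus the demand of
      \<open>A\<close>, and its degree is the boundary degree of \<open>A\<close>. The root bound is
      therefore precisely the tightness of \<open>A\<close>.\<close>
    have "dist_mult (2 * m) (sum p2 A - sum q2 A) = dist_mult (2 * m) (- sum b A)"
      using tot2 by (intro dist_mult_cong) (simp add: algebra_simps)
    then have "dist_mult (2 * m) (sum p2 A - sum q2 A) = dist_mult (2 * m) (sum b A)"
      using m by (simp add: dist_mult_minus)
    moreover have "boundary_degree A c p2 q2 A = sum p2 A + sum q2 A" by (simp add: boundary_degree_def cut_weight_def)
    ultimately show "sum p2 A + sum q2 A \<le> 2 * m - 2 + dist_mult (2 * m) (sum p2 A - sum q2 A)"
      using tight bdeg2[OF subset_refl] by linarith
    show "\<forall>B\<subseteq>A. even (boundary_degree A c p2 q2 B - sum b B)"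
    proof (intro allI impI)
      fix B assume "B \<subseteq> A"
      then have "B \<subseteq> V" using A by blast
      show "even (boundary_degree A c p2 q2 B - sum b B)"
        unfolding bdeg2[OF \<open>B \<subseteq> A\<close>] by (rule admissible_even[OF adm \<open>B \<subseteq> V\<close>])
    qed
    show "\<forall>B. B \<noteq> {} \<and> B \<subset> A \<and> \<not> (B = {x0} \<and> 2 * m dvd b x0) \<longrightarrow>
        2 * m - 2 + dist_mult (2 * m) (sum b B) \<le> boundary_degree A c p2 q2 B"
    proof (intro allI impI)
      fix B assume B: "B \<noteq> {} \<and> B \<subset> A \<and> \<not> (B = {x0} \<and> 2 * m dvd b x0)"
      then have "B \<subset> V" "B \<subseteq> A" using A by blast+
      show "2 * m - 2 + dist_mult (2 * m) (sum b B) \<le> boundary_degree A c p2 q2 B"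
        unfolding bdeg2[OF \<open>B \<subseteq> A\<close>] using B \<open>B \<subset> V\<close> by (intro admissible_cut[OF adm]) auto
    qed
  qed
  from inner[OF this] obtain f2 where f2: "solution m A c p2 q2 b f2" by blast
  \<comment> \<open>The inner solution inside \<open>A\<close>, the outer one outside, and the
    directions given by \<open>g\<close> across.\<close>
  define f where "f u v = (if u \<in> A then if v \<in> A then f2 u v else c v u - g v u
     else if v \<in> A then g u v else f1 u v)" for u v
  have "0 \<le> f u v \<and> f u v + f v u = c u v" if uv: "u \<in> V" "v \<in> V" "u \<noteq> v" for u v
  proof (cases "u \<in> A"; cases "v \<in> A")
    assume "u \<in> A" "v \<in> A"
    then show ?thesis using solutionD(1,2)[OF f2] uv by (simp add: f_def)
  next
    assume *: "u \<in> A" "v \<notin> A"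
    then have "v \<in> U" using uv by (simp add: U_def)
    from g0[OF this, of u] show ?thesis using * admissible_sym[OF adm, of v u] by (simp add: f_def)
  next
    assume *: "u \<notin> A" "v \<in> A"
    then have "u \<in> U" using uv by (simp add: U_def)
    from g0[OF this, of v] show ?thesis using * by (simp add: f_def)
  next
    assume *: "u \<notin> A" "v \<notin> A"
    then have "u \<in> U" "v \<in> U" using uv by (simp_all add: U_def)
    then show ?thesis using * solutionD(1,2)[OF outer UV(1) UV(1), of u v] cq_U[of u v] uv
      by (simp add: f_def)
  qed
  moreover have "2 * m dvd net V f v - (b v + p v - q v)" if "v \<in> V" for v
  proof -
    have "V = A \<union> U" "A \<inter> U = {}" using A by (auto simp: U_def)
    then have net_split: "net V f v = (\<Sum>u\<in>A. f v u - f u v) + (\<Sum>u\<in>U. f v u - f u v)"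
      using finVA finU by (simp add: net_def sum.union_disjoint)
    show ?thesis
    proof (cases "v \<in> A")
      case True
      have "(\<Sum>u\<in>A. f v u - f u v) = net A f2 v"
        unfolding net_def using True by (intro sum.cong) (auto simp: f_def)
      moreover have "(\<Sum>u\<in>U. f v u - f u v) = (\<Sum>u\<in>U. (c u v - g u v) - g u v)"
        using True by (intro sum.cong) (auto simp: f_def U_def)
      then have "(\<Sum>u\<in>U. f v u - f u v) = (\<Sum>u\<in>U. c u v - g u v) - (\<Sum>u\<in>U. g u v)"
        by (simp only: sum_subtractf)
      then have "(\<Sum>u\<in>U. f v u - f u v) = (q2 v - q v) - (p2 v - p v)"
        unfolding p2_def q2_def by linarith
      ultimately have "net V f v - (b v + p v - q v) = net A f2 v - (b v + p2 v - q2 v)"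
        using net_split by linarith
      then show ?thesis using solutionD(3)[OF f2 True] by (simp only:)
    next
      case False
      then have v: "v \<in> U" using that by (simp add: U_def)
      have "(\<Sum>u\<in>U. f v u - f u v) = (\<Sum>u\<in>U. f1 v u - f1 u v)"
        using False by (intro sum.cong) (auto simp: f_def U_def)
      moreover have "(\<Sum>u\<in>A. f v u - f u v) = (\<Sum>u\<in>A. g v u - (c v u - g v u))"
        using False by (intro sum.cong) (auto simp: f_def)
      then have "(\<Sum>u\<in>A. f v u - f u v) = sum (g v) A - (sum (c v) A - sum (g v) A)"
        by (simp only: sum_subtractf)
      then have "(\<Sum>u\<in>A. f v u - f u v) = f1 v r - f1 r v"
        using gsum[OF v] f1(3)[OF v] by linarith
      moreover have "net quot_verts f1 v = (f1 v r - f1 r v) + (\<Sum>u\<in>U. f1 v u - f1 u v)"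
        using finU A(3) by (simp add: net_def quot_verts_def U_def)
      ultimately have "net V f v = net quot_verts f1 v" using net_split by linarith
      moreover have "quot_sum h v = h v" for h using UV[OF v] by (simp add: quot_sum_def block_def)
      ultimately show ?thesis using solutionD(3)[OF outer UV(1)[OF v]] by simp
    qed
  qed
  ultimately show ?thesis unfolding solution_def by blast
qed

end

subsection \<open>The orientation theorem\<close>

text \<open>Deletes an arc from \<open>x\<close> to the root and lowers the demand of
  \<open>x\<close> accordingly. Degree and distance of \<open>{x}\<close> both fall, so its
  condition survives; at the root the degree falls by one and the distance by at most one.\<close>

lemma admissible_drop:
  assumes adm: "admissible m V c p q b x0" and m: "m > 0"
    and slack: "\<And>A. A \<subset> V \<Longrightarrow> 2 \<le> card A \<Longrightarrow> 2 * m + dist_mult (2 * m) (sum b A) \<le> boundary_degree V c p q A"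
    and nz: "\<And>v. v \<in> V \<Longrightarrow> \<not> 2 * m dvd b v"
    and x: "x \<in> V" "q x \<ge> 1" "dist_mult (2 * m) (b x - 1) \<le> dist_mult (2 * m) (b x) - 1"
  shows "admissible m V c p (\<lambda>v. q v - ind x v) (\<lambda>v. b v - ind x v) x0"
proof (rule admissible_step[OF adm slack])
  have fV: "finite V" using adm by (rule admissible_finite)
  have sumx: "(\<Sum>v\<in>A. h v - ind x v) = sum h A - of_bool (x \<in> A)" if "A \<subseteq> V" for A h
    using that fV by (simp add: sum_subtractf sum_ind finite_subset)
  have deg: "boundary_degree V c p (\<lambda>v. q v - ind x v) A = boundary_degree V c p q A - of_bool (x \<in> A)" if "A \<subseteq> V" for A
    using sumx[OF that, of q] by (simp add: boundary_degree_def)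
  show "(\<Sum>v\<in>V. b v - ind x v + p v - (q v - ind x v)) = (\<Sum>v\<in>V. b v + p v - q v)"
    by (rule sum.cong) auto
  show "even (boundary_degree V c p (\<lambda>v. q v - ind x v) A - boundary_degree V c p q A - ((\<Sum>v\<in>A. b v - ind x v) - sum b A))"
    if "A \<subseteq> V" for A
    unfolding deg[OF that] sumx[OF that] by simp
  have "dist_mult (2 * m) (sum p V - sum q V) \<le> dist_mult (2 * m) (sum p V - sum q V + 1) + 1"
    using dist_mult_add_le[of "2 * m" "sum p V - sum q V + 1" "-1"] m by simp
  moreover have s: "(\<Sum>v\<in>V. q v - ind x v) = sum q V - 1"
    using sumx[OF subset_refl, of q] x(1) by simp
  moreover have e: "sum p V - (sum q V - 1) = sum p V - sum q V + 1" by simp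
  ultimately show "sum p V + (\<Sum>v\<in>V. q v - ind x v)
      \<le> 2 * m - 2 + dist_mult (2 * m) (sum p V - (\<Sum>v\<in>V. q v - ind x v))"
    using admissible_root[OF adm] unfolding s e by linarith
  show "2 * m - 2 + dist_mult (2 * m) (b v - ind x v) \<le> boundary_degree V c p (\<lambda>v. q v - ind x v) {v}"
    if v: "v \<in> V" "V \<noteq> {v}" for v
  proof -
    have old: "2 * m - 2 + dist_mult (2 * m) (b v) \<le> boundary_degree V c p q {v}"
      using admissible_singleton[OF adm v] nz[OF v(1)] by blast
    have new: "boundary_degree V c p (\<lambda>v. q v - ind x v) {v} = boundary_degree V c p q {v} - ind x v"
      using deg[of "{v}"] v by (auto simp: ind_def)
    show ?thesis
    proof (cases "v = x")
      case True
      then show ?thesis using old x(3) unfolding new by (simp add: ind_def)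
    next
      case False
      then show ?thesis using old unfolding new by (simp add: ind_def)
    qed
  qed
  show "boundary_degree V c p q A - 2 - dist_mult (2 * m) (sum b A)
      \<le> boundary_degree V c p (\<lambda>v. q v - ind x v) A - dist_mult (2 * m) (\<Sum>v\<in>A. b v - ind x v)" if "A \<subset> V" for A
  proof -
    have A: "A \<subseteq> V" using that by auto
    have "dist_mult (2 * m) (sum b A + - of_bool (x \<in> A)) \<le> dist_mult (2 * m) (sum b A) + \<bar>- of_bool (x \<in> A)\<bar>"
      using m by (intro dist_mult_add_le) simp
    then show ?thesis unfolding deg[OF A] sumx[OF A] by (cases "x \<in> A") simp_all
  qed
  show "c u v = c v u" "0 \<le> c u v" "0 \<le> p v" for u v
    using admissible_sym[OF adm] admissible_nonneg[OF adm] by blast+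
  show "0 \<le> q v - ind x v" for v
    using admissible_nonneg(3)[OF adm, of v] x(2) by (simp add: ind_def)
qed

section \<open>Lower bounds on cuts, and graphs with two vertices\<close>

lemma boundary_degree_compl:
  assumes adm: "admissible m V c p q b x0" and A: "A \<subseteq> V"
  shows "boundary_degree V c p q A + boundary_degree V c p q (V - A) = 2 * cut_weight V c A + (sum p V + sum q V)"
proof -
  have "sum h V = sum h A + sum h (V - A)" for h :: "'a \<Rightarrow> int"
    using A admissible_finite[OF adm] by (simp add: sum.subset_diff)
  then show ?thesis
    using cut_weight_compl[OF A, of c] admissible_sym[OF adm] by (simp add: boundary_degree_def)
qed

text \<open>The divisibility of the total makes the imbalance of the root congruent to
  \<open>- sum b V\<close>.\<close>

lemma dist_mult_root:
  assumes adm: "admissible m V c p q b x0" and m: "m > 0"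
  shows "dist_mult (2 * m) (sum p V - sum q V) = dist_mult (2 * m) (sum b V)"
proof -
  have "2 * m dvd sum p V - sum q V - (- sum b V)"
    using admissible_total[OF adm] by (simp add: sum.distrib sum_subtractf algebra_simps)
  then have "dist_mult (2 * m) (sum p V - sum q V) = dist_mult (2 * m) (- sum b V)" by (rule dist_mult_cong)
  then show ?thesis using m by (simp add: dist_mult_minus)
qed

text \<open>The cut conditions for \<open>A\<close> and \<open>V - A\<close> add up to twice the cut
  plus the degree of the root. The root bound and the subadditivity of the distance leave
  \<open>2 * m - 2\<close> for twice the cut.\<close>

lemma cut_weight_lower:
  assumes adm: "admissible m V c p q b x0" and m: "m > 0"
    and A: "A \<noteq> {}" "A \<subset> V" "\<not> (A = {x0} \<and> 2 * m dvd b x0)" "\<not> (V - A = {x0} \<and> 2 * m dvd b x0)"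
  shows "m - 1 \<le> cut_weight V c A"
proof -
  have "2 * m - 2 + dist_mult (2 * m) (sum b A) \<le> boundary_degree V c p q A"
    using A by (intro admissible_cut[OF adm])
  moreover have "2 * m - 2 + dist_mult (2 * m) (sum b (V - A)) \<le> boundary_degree V c p q (V - A)"
    using A by (intro admissible_cut[OF adm]) auto
  moreover have "sum b V = sum b A + sum b (V - A)"
    using A admissible_finite[OF adm] sum.subset_diff[of A V b] by auto
  then have "dist_mult (2 * m) (sum b V) \<le> dist_mult (2 * m) (sum b A) + dist_mult (2 * m) (sum b (V - A))"
    using dist_mult_add[of "2 * m" "sum b A" "sum b (V - A)"] m by simp
  moreover note boundary_degree_compl[OF adm, of A] dist_mult_root[OF adm m] admissible_root[OF adm]
  ultimately show ?thesis using A(2) by (simp add: psubset_imp_subset)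
qed

lemma cut_weight_pos:
  assumes "0 < cut_weight V c A"
  obtains w y where "w \<in> A" "y \<in> V - A" "1 \<le> c w y"
proof -
  have "\<exists>w\<in>A. \<exists>y\<in>V - A. 1 \<le> c w y"
  proof (rule ccontr)
    assume "\<not> ?thesis"
    then have "cut_weight V c A \<le> 0" unfolding cut_weight_def by (intro sum_nonpos) force
    then show False using assms by simp
  qed
  then show ?thesis using that by blast
qed

text \<open>With \<open>e\<close> parallel edges, \<open>x\<close> can have any net outflow of the
  parity of \<open>e\<close> and absolute value at most \<open>e\<close>. The value \<open>n\<close>
  is a representative of its demand nearest to 0, attained with \<open>k\<close> edges out of
  \<open>x\<close>; the congruence at \<open>y\<close> follows from the total.\<close>

lemma solution_two:
  assumes adm: "admissible m V c p q b x0" and V: "V = {x, y}" "x \<noteq> y"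
    and m: "m > 0" and le: "dist_mult (2 * m) (b x + p x - q x) \<le> c x y"
  shows "\<exists>f. solution m V c p q b f"
proof -
  define e where "e = c x y"
  define t where "t = b x + p x - q x"
  obtain j where j: "dist_mult (2 * m) t = \<bar>t - 2 * m * j\<bar>" using dist_mult_attained[of "2 * m" t] m by auto
  define n where "n = t - 2 * m * j"
  have n: "\<bar>n\<bar> \<le> e" using le j by (simp add: e_def n_def t_def)
  have "even (boundary_degree V c p q {x} - b x)" using admissible_even[OF adm, of "{x}"] V by simp
  then have "even (e + n)" using V by (auto simp: boundary_degree_def cut_weight_def e_def n_def t_def)
  then obtain k where k: "e + n = 2 * k" by blast
  define f where "f u v = (if u = x then k else e - k)" for u v :: 'a
  have fk: "0 \<le> k" "k \<le> e" using n k by linarith+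
  have cyx: "c y x = e" unfolding e_def by (rule admissible_sym[OF adm])
  have nx: "net V f x = n" "net V f y = - n" using V k by (auto simp: net_def f_def)
  have tx: "2 * m dvd n - (b x + p x - q x)" by (simp add: n_def t_def)
  have "2 * m dvd (b x + p x - q x) + (b y + p y - q y)"
    using admissible_total[OF adm] V by simp
  then have "2 * m dvd - ((n - (b x + p x - q x)) + ((b x + p x - q x) + (b y + p y - q y)))"
    using tx by (simp only: dvd_minus_iff dvd_add)
  then have ty: "2 * m dvd - n - (b y + p y - q y)" by (simp add: algebra_simps)
  have "solution m V c p q b f"
    unfolding solution_def
  proof (intro conjI ballI impI)
    fix u v assume uv: "u \<in> V" "v \<in> V" "u \<noteq> v"
    then have "(u = x \<and> v = y) \<or> (u = y \<and> v = x)" using V by auto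
    then show "0 \<le> f u v" "f u v + f v u = c u v"
      using fk V cyx by (auto simp: f_def e_def)
  next
    fix v assume "v \<in> V"
    then show "2 * m dvd net V f v - (b v + p v - q v)" using nx tx ty V by auto
  qed
  then show ?thesis by blast
qed

text \<open>The demand of \<open>x\<close> vanishes modulo \<open>2 * m\<close>, so only
  \<open>p x - q x\<close> matters. The cut condition at \<open>y\<close> and the root bound give
  \<open>p x + q x \<le> c x y\<close>.\<close>

lemma two_bound_exempt:
  assumes adm: "admissible m V c p q b x" and V: "V = {x, y}" "x \<noteq> y"
    and m: "m > 0" and ex: "2 * m dvd b x"
  shows "dist_mult (2 * m) (b x + p x - q x) \<le> c x y"
proof -
  have y: "2 * m - 2 + dist_mult (2 * m) (b y) \<le> boundary_degree V c p q {y}"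
    using admissible_singleton[OF adm, of y] V by auto
  have "V - {x} = {y}" using V by auto
  have cx: "cut_weight V c {x} = c x y" using V by (simp add: cut_weight_def)
  have "dist_mult (2 * m) (sum b V) = dist_mult (2 * m) (b y)"
    using V ex by (intro dist_mult_cong) simp
  then have "c x y + p x + q x + boundary_degree V c p q {y} = 2 * c x y + (sum p V + sum q V)"
      "sum p V + sum q V \<le> 2 * m - 2 + dist_mult (2 * m) (b y)"
    using boundary_degree_compl[OF adm, of "{x}"] cx \<open>V - {x} = {y}\<close> V admissible_root[OF adm] dist_mult_root[OF adm m]
    by (simp_all add: boundary_degree_def)
  then have "p x + q x \<le> c x y" using y by linarith
  moreover have "dist_mult (2 * m) (b x + p x - q x) = dist_mult (2 * m) (p x - q x)"
    using ex by (intro dist_mult_cong) (simp add: algebra_simps)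
  moreover have "dist_mult (2 * m) (p x - q x) \<le> \<bar>p x - q x\<bar>" using m by (intro dist_mult_le_abs) simp
  moreover have "0 \<le> p x" "0 \<le> q x" using admissible_nonneg[OF adm] by auto
  ultimately show ?thesis by linarith
qed

text \<open>The distance is at most \<open>m\<close> and \<open>c x y\<close> is at least
  \<open>m - 1\<close>. The only bad case, a distance of \<open>c x y + 1\<close>, is excluded by
  parity.\<close>

lemma two_bound:
  assumes adm: "admissible m V c p q b x0" and V: "V = {x, y}" "x \<noteq> y"
    and m: "m > 0" and nex: "\<not> (x0 \<in> V \<and> 2 * m dvd b x0)"
  shows "dist_mult (2 * m) (b x + p x - q x) \<le> c x y"
proof -
  have "V - {x} = {y}" using V by auto
  have cx: "cut_weight V c {x} = c x y" using V by (simp add: cut_weight_def)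
  have "m - 1 \<le> c x y"
    using cut_weight_lower[OF adm m, of "{x}"] V nex unfolding \<open>V - {x} = {y}\<close> cx by auto
  moreover have "2 * dist_mult (2 * m) (b x + p x - q x) \<le> 2 * m" by (rule dist_mult_le_half)
  moreover have "even (dist_mult (2 * m) (b x + p x - q x)) \<longleftrightarrow> even (c x y)"
  proof -
    have "even (boundary_degree V c p q {x} - b x)" using admissible_even[OF adm, of "{x}"] V by simp
    then have "even (c x y + p x + q x - b x)" using cx by (simp add: boundary_degree_def)
    then have "even (c x y) \<longleftrightarrow> even (b x + p x - q x)" by auto
    then show ?thesis by (simp add: even_dist_mult)
  qed
  ultimately show ?thesis by (cases "dist_mult (2 * m) (b x + p x - q x) = c x y + 1") auto
qed


section \<open>Induction measures and the cases of the induction step\<close>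

definition total_weight :: "'a set \<Rightarrow> ('a \<Rightarrow> 'a \<Rightarrow> int) \<Rightarrow> int" where
  "total_weight V c = (\<Sum>u\<in>V. \<Sum>v\<in>V. c u v)"

lemma total_weight_edge:
  assumes "finite V" "x \<in> V" "y \<in> V"
  shows "total_weight V (edge x y) = 2"
proof -
  have "total_weight V (arc x y) = 1" if "x \<in> V" "y \<in> V" for x y
  proof -
    have "total_weight V (arc x y) = (\<Sum>a\<in>V. \<Sum>u\<in>V. ind x a * ind y u)"
      by (simp add: total_weight_def arc_def ind_def of_bool_conj)
    also have "\<dots> = sum (ind x) V * sum (ind y) V" by (simp add: sum_product)
    finally show ?thesis using that assms(1) by (simp add: sum_ind)
  qed
  then show ?thesis using assms by (simp add: total_weight_def edge_def sum.distrib)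
qed

lemma total_weight_add: "total_weight V (\<lambda>u v. c u v + d u v) = total_weight V c + total_weight V d"
  by (simp add: total_weight_def sum.distrib)

lemma total_weight_diff: "total_weight V (\<lambda>u v. c u v - d u v) = total_weight V c - total_weight V d"
  by (simp add: total_weight_def sum_subtractf)

lemma total_weight_nonneg:
  assumes "admissible m V c p q b x0"
  shows "0 \<le> total_weight V c"
  using admissible_nonneg(1)[OF assms] by (simp add: total_weight_def sum_nonneg)

lemma root_sum_nonneg:
  assumes "admissible m V c p q b x0"
  shows "0 \<le> sum p V" "0 \<le> sum q V"
  using admissible_nonneg(2,3)[OF assms] by (simp_all add: sum_nonneg)

text \<open>If \<open>x0\<close> exempts no set, all cut conditions hold, and the exemption may be
  passed on to any vertex.\<close>

lemma admissible_all_exempt: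
  assumes "admissible m V c p q b x0" "\<not> (x0 \<in> V \<and> 2 * m dvd b x0)"
  shows "admissible m V c p q b x"
proof -
  have "2 * m - 2 + dist_mult (2 * m) (sum b A) \<le> boundary_degree V c p q A" if "A \<noteq> {}" "A \<subset> V" for A
    using that assms(2) by (intro admissible_cut[OF assms(1)]) auto
  then have *: "\<forall>A. A \<noteq> {} \<and> A \<subset> V \<and> \<not> (A = {x} \<and> 2 * m dvd b x) \<longrightarrow>
      2 * m - 2 + dist_mult (2 * m) (sum b A) \<le> boundary_degree V c p q A" by blast
  show ?thesis
    using assms(1) unfolding admissible_def
    by (elim conjE) (intro conjI; (assumption | rule *))
qed

text \<open>\<open>P\<close> is the degree of a root with outgoing arcs only, and \<open>g\<close>
  artificial arcs into it are added. For \<open>P\<close> from \<open>2 * m\<close> to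
  \<open>3 * m - 2\<close> the distance is \<open>P - 2 * m\<close>, which contradicts the bound; so
  \<open>P \<le> 2 * m - 1\<close>, and that suffices both for \<open>P - g\<close> up to
  \<open>m\<close> and beyond it.\<close>

lemma root_fake:
  fixes P g m :: int
  assumes m: "m > 0" and P: "0 \<le> P" "P \<le> 2 * m - 2 + dist_mult (2 * m) P" and g: "0 \<le> g" "g \<le> m - 1"
  shows "P + g \<le> 2 * m - 2 + dist_mult (2 * m) (P - g)"
proof -
  have shift: "dist_mult (2 * m) x = \<bar>x - 2 * m\<bar>" if "\<bar>x - 2 * m\<bar> \<le> m" for x
  proof -
    have "dist_mult (2 * m) x = dist_mult (2 * m) (x - 2 * m)" by (rule dist_mult_cong) simp
    then show ?thesis using that m by (simp add: dist_mult_eq_abs)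
  qed
  have "2 * dist_mult (2 * m) P \<le> 2 * m" by (rule dist_mult_le_half)
  then have "P \<le> 3 * m - 2" using P by linarith
  have "P \<le> 2 * m - 1"
  proof (rule ccontr)
    assume "\<not> ?thesis"
    then show False using shift[of P] P \<open>P \<le> 3 * m - 2\<close> by linarith
  qed
  show ?thesis
  proof (cases "P - g \<le> m")
    case True
    then have "dist_mult (2 * m) (P - g) = \<bar>P - g\<bar>" using m g P by (intro dist_mult_eq_abs) auto
    then show ?thesis using g True P by linarith
  next
    case False
    then have "dist_mult (2 * m) (P - g) = 2 * m - (P - g)" using shift[of "P - g"] g \<open>P \<le> 2 * m - 1\<close> by linarith
    then show ?thesis using \<open>P \<le> 2 * m - 1\<close> by linarith
  qed
qed

lemma solution_drop:
  assumes "solution m V c p q' b' f" "\<And>v. b' v + p v - q' v = b v + p v - q v"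
  shows "solution m V c p q b f"
  using assms unfolding solution_def by simp

text \<open>Without negative demands there is no edge that can be directed and deleted for free. An
  arc into the root is dropped if there is one; otherwise the root has outgoing arcs only and
  tolerates the artificial arcs that make the demand of a vertex \<open>y\<close> negative. These
  arcs enlarge the root degree, but the total weight falls.\<close>

lemma positive_case:
  assumes adm: "admissible m V c p q b x0" and m: "m \<ge> 2" and card: "3 \<le> card V"
    and slack: "\<And>A. A \<subset> V \<Longrightarrow> 2 \<le> card A \<Longrightarrow> 2 * m + dist_mult (2 * m) (sum b A) \<le> boundary_degree V c p q A"
    and pos: "\<And>v. v \<in> V \<Longrightarrow> 0 < b v mod (2 * m) \<and> b v mod (2 * m) \<le> m"
    and IH_c: "\<And>c' p' q' b'. admissible m V c' p' q' b' x0 \<Longrightarrow> total_weight V c' < total_weight V c \<Longrightarrow>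
      \<exists>f. solution m V c' p' q' b' f"
    and IH_r: "\<And>p' q' b'. admissible m V c p' q' b' x0 \<Longrightarrow>
      sum p' V + sum q' V < sum p V + sum q V \<Longrightarrow> \<exists>f. solution m V c p' q' b' f"
  shows "\<exists>f. solution m V c p q b f"
proof -
  have fV: "finite V" using adm by (rule admissible_finite)
  have nz: "\<not> 2 * m dvd b v" if "v \<in> V" for v
    using pos[OF that] by (simp add: dvd_eq_mod_eq_0)
  have less: "dist_mult (2 * m) (b v - 1) \<le> dist_mult (2 * m) (b v) - 1" if "v \<in> V" for v
    using dist_mult_diff_one[of "b v" "2 * m"] pos[OF that] by simp
  show ?thesis
  proof (cases "\<exists>x\<in>V. 1 \<le> q x")
    case True
    then obtain x where x: "x \<in> V" "1 \<le> q x" by blast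
    have "admissible m V c p (\<lambda>v. q v - ind x v) (\<lambda>v. b v - ind x v) x0"
      using m x less by (intro admissible_drop[OF adm _ slack nz]) auto
    moreover have "sum p V + (\<Sum>v\<in>V. q v - ind x v) < sum p V + sum q V"
      using fV x by (simp add: sum_subtractf sum_ind)
    ultimately obtain f where "solution m V c p (\<lambda>v. q v - ind x v) (\<lambda>v. b v - ind x v) f"
      using IH_r by blast
    then have "solution m V c p q b f" by (rule solution_drop) simp
    then show ?thesis by blast
  next
    case False
    then have "q x = 0" if "x \<in> V" for x
      using that admissible_nonneg(3)[OF adm, of x] by fastforce
    then have q0: "sum q V = 0" by simp
    obtain x where x: "x \<in> V" using card by fastforce
    have "V \<noteq> {x}" using card by auto
    \<comment> \<open>Here \<open>m \<ge> 2\<close> provides an edge at \<open>x\<close>.\<close>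
    then have "m - 1 \<le> cut_weight V c {x}"
      using x nz m by (intro cut_weight_lower[OF adm]) auto
    then have "0 < cut_weight V c {x}" using m by linarith
    then obtain w y where "w \<in> {x}" "y \<in> V - {x}" "1 \<le> c w y" by (rule cut_weight_pos)
    then have y: "y \<in> V" "x \<noteq> y" "1 \<le> c x y" by auto
    \<comment> \<open>The number of artificial arcs that raises the residue of \<open>y\<close> to
      \<open>m\<close>. The edge directed into \<open>y\<close> then makes it \<open>m + 1\<close>,
      at distance \<open>m - 1\<close>, which is the old distance plus \<open>g\<close> minus
      1.\<close>
    define g where "g = m - b y mod (2 * m)"
    have g: "0 \<le> g" "g \<le> m - 1" using pos[OF y(1)] by (auto simp: g_def)
    have "dist_mult (2 * m) (b y + g + 1) = dist_mult (2 * m) (m + 1)"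
      by (rule dist_mult_cong) (simp add: g_def mod_eq_dvd_iff[symmetric])
    also have "\<dots> = m - 1" using dist_mult_add_one(2)[of "2 * m" m] m by simp
    finally have "dist_mult (2 * m) (b y + g + 1) \<le> dist_mult (2 * m) (b y) + g - 1"
      using dist_mult_diff_one(1)[of "b y" "2 * m"] pos[OF y(1)] by (simp add: g_def)
    moreover have "sum p V + sum q V + g \<le> 2 * m - 2 + dist_mult (2 * m) (sum p V - sum q V - g)"
      using root_fake[of m "sum p V" g] admissible_root[OF adm] root_sum_nonneg(1)[OF adm] q0 g m by simp
    ultimately have "admissible m V (\<lambda>u v. c u v - edge x y u v) p (\<lambda>v. q v + g * ind y v)
        (\<lambda>v. b v - ind x v + (g + 1) * ind y v) x0"
      using m x y g less by (intro admissible_orient[OF adm _ slack nz]) auto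
    moreover have "total_weight V (\<lambda>u v. c u v - edge x y u v) < total_weight V c"
      using fV x y by (simp add: total_weight_diff total_weight_edge)
    ultimately obtain f where f: "solution m V (\<lambda>u v. c u v - edge x y u v) p (\<lambda>v. q v + g * ind y v)
        (\<lambda>v. b v - ind x v + (g + 1) * ind y v) f" using IH_c by blast
    have "solution m V c p q b (\<lambda>u v. f u v + arc x y u v)"
      by (rule solution_arc[OF fV x y(1,2) f]) (simp add: algebra_simps)
    then show ?thesis by blast
  qed
qed

text \<open>The vertex \<open>x\<close> has a neighbour \<open>s\<close>. An edge to
  \<open>s\<close> is lifted together with an edge to another neighbour or with a root arc at
  \<open>x\<close>; if there is neither, \<open>s\<close> is the only neighbour and \<open>x\<close>
  is deleted. Lifting may ruin the cut condition at \<open>{x}\<close>, which explains the exemption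
  in \<open>admissible\<close>.\<close>

lemma exempt_case:
  assumes adm: "admissible m V c p q b x" and m: "m > 0" and card: "3 \<le> card V"
    and slack: "\<And>A. A \<subset> V \<Longrightarrow> 2 \<le> card A \<Longrightarrow> 2 * m + dist_mult (2 * m) (sum b A) \<le> boundary_degree V c p q A"
    and x: "x \<in> V" "2 * m dvd b x"
    and IH_c: "\<And>c' p' q'. admissible m V c' p' q' b x \<Longrightarrow> total_weight V c' < total_weight V c \<Longrightarrow>
      \<exists>f. solution m V c' p' q' b f"
    and IH_V: "\<And>V'. admissible m V' c p q b x \<Longrightarrow> card V' < card V \<Longrightarrow> \<exists>f. solution m V' c p q b f"
  shows "\<exists>f. solution m V c p q b f"
proof -
  have fV: "finite V" using adm by (rule admissible_finite)
  note sym = admissible_sym[OF adm]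
  note nonneg = admissible_nonneg[OF adm]
  \<comment> \<open>If \<open>x\<close> had no neighbour in \<open>V\<close>, only root edges would
    leave \<open>V - {x}\<close>. Having at least two vertices, that set has slack 2 by
    \<open>slack\<close>, against the root bound.\<close>
  have "\<exists>s\<in>V. s \<noteq> x \<and> 1 \<le> c x s"
  proof (rule ccontr)
    assume no: "\<not> ?thesis"
    have "\<not> 0 < cut_weight V c {x}"
    proof
      assume "0 < cut_weight V c {x}"
      then obtain w y where "w \<in> {x}" "y \<in> V - {x}" "1 \<le> c w y" by (rule cut_weight_pos)
      then show False using no by auto
    qed
    then have "cut_weight V c (V - {x}) \<le> 0" using cut_weight_compl[of "{x}" V c] sym x by simp
    moreover have "2 * m + dist_mult (2 * m) (sum b (V - {x})) \<le> boundary_degree V c p q (V - {x})"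
      using card x fV by (intro slack) auto
    moreover have sub: "sum h V = sum h (V - {x}) + h x" for h :: "'a \<Rightarrow> int"
      using fV x(1) by (simp add: sum.remove)
    moreover have "dist_mult (2 * m) (sum b V) = dist_mult (2 * m) (sum b (V - {x}))"
      using x(2) unfolding sub[of b] by (intro dist_mult_cong) simp
    ultimately show False
      using admissible_root[OF adm] dist_mult_root[OF adm m] nonneg(2)[of x] nonneg(3)[of x]
      unfolding boundary_degree_def sub[of p] sub[of q] by linarith
  qed
  then obtain s where s: "s \<in> V" "s \<noteq> x" "1 \<le> c x s" by blast
  have less1: "total_weight V (\<lambda>u v. c u v - edge x s u v) < total_weight V c"
    using fV x s by (simp add: total_weight_diff total_weight_edge)
  consider (lift) t where "t \<in> V" "t \<noteq> x" "s \<noteq> t" "1 \<le> c x t"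
    | (out) "1 \<le> p x" | (into) "1 \<le> q x"
    | (leaf) "p x = 0" "q x = 0" "\<And>u. u \<in> V \<Longrightarrow> u \<noteq> x \<Longrightarrow> u \<noteq> s \<Longrightarrow> c x u = 0"
  proof -
    have "c x u = 0" if "\<not> 1 \<le> c x u" for u using that nonneg(1)[of x u] by linarith
    moreover have "p x = 0" if "\<not> 1 \<le> p x" using that nonneg(2)[of x] by linarith
    moreover have "q x = 0" if "\<not> 1 \<le> q x" using that nonneg(3)[of x] by linarith
    ultimately show ?thesis using that by metis
  qed
  then show ?thesis
  proof cases
    case lift
    have "admissible m V (\<lambda>u v. c u v - edge x s u v - edge x t u v + edge s t u v) p q b x"
      using m x s lift by (intro admissible_lift[OF adm slack]) auto
    moreover have "total_weight V (\<lambda>u v. c u v - edge x s u v - edge x t u v + edge s t u v) < total_weight V c"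
      using fV x s lift by (simp add: total_weight_add total_weight_diff total_weight_edge)
    ultimately obtain f where
      f: "solution m V (\<lambda>u v. c u v - edge x s u v - edge x t u v + edge s t u v) p q b f"
      using IH_c by blast
    show ?thesis
      using solution_lift[of V x s c t m p q b f, OF fV x(1) s lift(1,2,4,3) f sym nonneg(1)] .
  next
    case out
    have "admissible m V (\<lambda>u v. c u v - edge x s u v) (\<lambda>v. p v - ind x v + ind s v) q b x"
      using m x s out by (intro admissible_lift_root[OF adm slack]) auto
    then obtain f where f: "solution m V (\<lambda>u v. c u v - edge x s u v) (\<lambda>v. p v - ind x v + ind s v) q b f"
      using IH_c less1 by blast
    have "solution m V c p q b (\<lambda>u v. f u v + arc x s u v)"
      using s by (intro solution_arc[OF fV x(1) s(1) _ f]) auto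
    then show ?thesis by blast
  next
    case into
    have slack': "2 * m + dist_mult (2 * m) (\<Sum>v\<in>A. - b v) \<le> boundary_degree V c q p A" if "A \<subset> V" "2 \<le> card A" for A
      using slack[OF that] m by (simp add: sum_negf dist_mult_minus boundary_degree_def)
    have "admissible m V (\<lambda>u v. c u v - edge x s u v) (\<lambda>v. q v - ind x v + ind s v) p (\<lambda>v. - b v) x"
      using m x s into by (intro admissible_lift_root[OF admissible_flip[OF adm m] slack']) auto
    from admissible_flip[OF this m]
    have "admissible m V (\<lambda>u v. c u v - edge x s u v) p (\<lambda>v. q v - ind x v + ind s v) b x" by simp
    then obtain f where f: "solution m V (\<lambda>u v. c u v - edge x s u v) p (\<lambda>v. q v - ind x v + ind s v) b f"
      using IH_c less1 by blast
    have e: "edge x s = edge s x" by (simp add: fun_eq_iff edge_def)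
    have "solution m V c p q b (\<lambda>u v. f u v + arc s x u v)"
      using s f unfolding e by (intro solution_arc[OF fV s(1) x(1)]) auto
    then show ?thesis by blast
  next
    case leaf
    have "admissible m (V - {x}) c p q b x"
      using x s leaf by (intro admissible_delete[OF adm slack]) auto
    moreover have "card (V - {x}) < card V" using fV x(1) by (rule card_Diff1_less)
    ultimately obtain f where "solution m (V - {x}) c p q b f" using IH_V by blast
    from solution_delete[OF adm x leaf(1,2) s(1,2) leaf(3) this] show ?thesis by blast
  qed
qed


text \<open>The three induction hypotheses, for fewer vertices, for less weight on the same
  vertices, and for a smaller root degree with the same weights, are the components of a
  lexicographic order.\<close>

lemma orientation_step:
  fixes V :: "'a set"
  assumes adm: "admissible m V c p q b x0" and m: "m \<ge> 2"
    and IH_V: "\<And>(V' :: 'a set) c' p' q' b' x'. admissible m V' c' p' q' b' x' \<Longrightarrow> card V' < card V \<Longrightarrow>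
      \<exists>f. solution m V' c' p' q' b' f"
    and IH_c: "\<And>c' p' q' b' x'. admissible m V c' p' q' b' x' \<Longrightarrow> total_weight V c' < total_weight V c \<Longrightarrow>
      \<exists>f. solution m V c' p' q' b' f"
    and IH_r: "\<And>p' q' b' x'. admissible m V c p' q' b' x' \<Longrightarrow>
      sum p' V + sum q' V < sum p V + sum q V \<Longrightarrow> \<exists>f. solution m V c p' q' b' f"
  shows "\<exists>f. solution m V c p q b f"
proof -
  have m0: "m > 0" using m by simp
  have fV: "finite V" using adm by (rule admissible_finite)
  consider "card V = 0" | "card V = 1" | "card V = 2" | "3 \<le> card V" by linarith
  then show ?thesis
  proof cases
    case 1
    then have "V = {}" using fV by simp
    then show ?thesis by (simp add: solution_def)
  next
    case 2
    then obtain v where V: "V = {v}" by (rule card_1_singletonE)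
    have "2 * m dvd - (b v + p v - q v)"
      using admissible_total[OF adm] V by (simp only: dvd_minus_iff) simp
    then have "solution m V c p q b (\<lambda>_ _. 0)" using V by (simp add: solution_def net_def)
    then show ?thesis by blast
  next
    case 3
    then obtain x y where V: "V = {x, y}" "x \<noteq> y" by (auto simp: card_2_iff)
    show ?thesis
    proof (cases "x0 \<in> V \<and> 2 * m dvd b x0")
      case True
      then consider "x0 = x" | "x0 = y" using V by auto
      then show ?thesis
      proof cases
        case 1
        then show ?thesis using two_bound_exempt[of m V c p q b x y] solution_two[OF adm V m0] adm V m0 True
          by simp
      next
        case 2
        have V': "V = {y, x}" "y \<noteq> x" using V by auto
        show ?thesis
          using two_bound_exempt[of m V c p q b y x] solution_two[OF adm V' m0] adm V' m0 True 2
          by simp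
      qed
    next
      case False
      show ?thesis by (rule solution_two[OF adm V m0 two_bound[OF adm V m0 False]])
    qed
  next
    case 4
    show ?thesis
    proof (cases "\<exists>A. A \<subset> V \<and> 2 \<le> card A \<and> boundary_degree V c p q A \<le> 2 * m - 2 + dist_mult (2 * m) (sum b A)")
      case True
      then obtain A where A: "A \<subset> V" "2 \<le> card A"
        and tight: "boundary_degree V c p q A \<le> 2 * m - 2 + dist_mult (2 * m) (sum b A)" by blast
      obtain r where r: "r \<in> A" using A(2) by fastforce
      obtain f1 where f1: "solution m (quot_verts V A r) (quot_weight A c r) (quot_sum A r p) (quot_sum A r q) (quot_sum A r b) f1"
        using IH_V[OF admissible_quotient[OF adm A r]] card_quot_verts[OF adm A r] by blast
      have "card A < card V" using fV A(1) by (rule psubset_card_mono)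
      then show ?thesis
        using solution_contract[OF adm A r m0 tight f1] IH_V by blast
    next
      case False
      \<comment> \<open>No set with at least two vertices is tight, and parity improves the strict
        inequality by one more.\<close>
      have slack: "2 * m + dist_mult (2 * m) (sum b A) \<le> boundary_degree V c p q A" if "A \<subset> V" "2 \<le> card A" for A
      proof -
        have "even (boundary_degree V c p q A - sum b A)" using that by (intro admissible_even[OF adm]) auto
        then have "even (boundary_degree V c p q A) \<longleftrightarrow> even (dist_mult (2 * m) (sum b A))" by (simp add: even_dist_mult)
        moreover have "2 * m - 2 + dist_mult (2 * m) (sum b A) < boundary_degree V c p q A" using False that by auto
        ultimately show ?thesis
          by (cases "boundary_degree V c p q A = 2 * m - 1 + dist_mult (2 * m) (sum b A)") auto
      qed
      show ?thesis
      proof (cases "\<exists>x\<in>V. 2 * m dvd b x")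
        case True
        \<comment> \<open>The exemption belongs to a vertex of zero demand: to \<open>x0\<close> if
          it is one, and otherwise it is still free to be given away.\<close>
        obtain x where x: "x \<in> V" "2 * m dvd b x" "admissible m V c p q b x"
        proof (cases "x0 \<in> V \<and> 2 * m dvd b x0")
          case True
          then show ?thesis using that adm by blast
        next
          case False
          obtain x where "x \<in> V" "2 * m dvd b x" using \<open>\<exists>x\<in>V. 2 * m dvd b x\<close> by blast
          then show ?thesis using that admissible_all_exempt[OF adm False] by blast
        qed
        show ?thesis by (rule exempt_case[OF x(3) m0 4 slack x(1,2) IH_c IH_V])
      next
        case False
        then have nz: "\<not> 2 * m dvd b v" if "v \<in> V" for v using that by blast
        have res: "0 < b v mod (2 * m)" "b v mod (2 * m) < 2 * m" if "v \<in> V" for v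
        proof -
          have "0 \<le> b v mod (2 * m)" "b v mod (2 * m) \<noteq> 0"
            using m0 nz[OF that] by (simp_all add: dvd_eq_mod_eq_0)
          then show "0 < b v mod (2 * m)" by linarith
          show "b v mod (2 * m) < 2 * m" using m0 by simp
        qed
        \<comment> \<open>The vertices of positive demand. A residue equal to \<open>m\<close> could
          be read either way and is counted as positive.\<close>
        define P where "P = {v \<in> V. b v mod (2 * m) \<le> m}"
        consider "P = V" | "P = {}" | "P \<noteq> {}" "P \<subset> V" by (auto simp: P_def)
        then show ?thesis
        proof cases
          case 1
          then have pos: "0 < b v mod (2 * m) \<and> b v mod (2 * m) \<le> m" if "v \<in> V" for v
            using that res[OF that] unfolding P_def by blast
          show ?thesis by (rule positive_case[OF adm m 4 slack pos IH_c IH_r])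
        next
          case 2
          have slack': "2 * m + dist_mult (2 * m) (\<Sum>v\<in>A. - b v) \<le> boundary_degree V c q p A" if "A \<subset> V" "2 \<le> card A" for A
            using slack[OF that] m0 by (simp add: sum_negf dist_mult_minus boundary_degree_def)
          \<comment> \<open>Negation sends a residue above \<open>m\<close> to one below
            \<open>m\<close>, so the reversed graph is an instance of the positive case.\<close>
          have pos': "0 < - b v mod (2 * m) \<and> - b v mod (2 * m) \<le> m" if "v \<in> V" for v
          proof -
            have "- b v mod (2 * m) = 2 * m - b v mod (2 * m)"
              using nz[OF that] by (simp add: zmod_zminus1_eq_if dvd_eq_mod_eq_0)
            moreover have "\<not> b v mod (2 * m) \<le> m" using 2 that unfolding P_def by blast
            ultimately show ?thesis using res[OF that] by linarith
          qed
          have IH_r': "\<exists>f. solution m V c p' q' b' f"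
            if "admissible m V c p' q' b' x0" "sum p' V + sum q' V < sum q V + sum p V" for p' q' b'
            using IH_r[OF that(1)] that(2) by (simp add: add.commute)
          have "\<exists>f. solution m V c q p (\<lambda>v. - b v) f"
            by (rule positive_case[OF admissible_flip[OF adm m0] m 4 slack' pos' IH_c IH_r'])
          then obtain f where f: "solution m V c q p (\<lambda>v. - b v) f" by blast
          have "solution m V c p q b (\<lambda>u v. f v u)"
            by (rule solution_flip[OF f admissible_sym[OF adm]])
          then show ?thesis by blast
        next
          case 3
          have "m - 1 \<le> cut_weight V c P"
            using 3 nz by (intro cut_weight_lower[OF adm m0]) auto
          then have "0 < cut_weight V c P" using m by linarith
          then obtain w y where wy: "w \<in> P" "y \<in> V - P" "1 \<le> c w y" by (rule cut_weight_pos)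
          then have wy': "w \<in> V" "y \<in> V" "w \<noteq> y" "b w mod (2 * m) \<le> m" "m < b y mod (2 * m)"
            by (auto simp: P_def)
          have "dist_mult (2 * m) (b w - 1) \<le> dist_mult (2 * m) (b w) - 1"
            using dist_mult_diff_one[of "b w" "2 * m"] wy'(4) res[OF wy'(1)] by simp
          \<comment> \<open>The demand of \<open>y\<close> is already negative, so no artificial
            arcs are inserted and \<open>g\<close> is 0.\<close>
          moreover have "dist_mult (2 * m) (b y + 0 + 1) \<le> dist_mult (2 * m) (b y) + 0 - 1"
            using dist_mult_add_one[of "2 * m" "b y"] wy'(5) m0 by simp
          ultimately have "admissible m V (\<lambda>u v. c u v - edge w y u v) p (\<lambda>v. q v + 0 * ind y v)
              (\<lambda>v. b v - ind w v + (0 + 1) * ind y v) x0"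
            using wy(3) wy'(1-3) admissible_root[OF adm] by (intro admissible_orient[OF adm m0 slack nz]) auto
          moreover have "total_weight V (\<lambda>u v. c u v - edge w y u v) < total_weight V c"
            using fV wy' by (simp add: total_weight_diff total_weight_edge)
          ultimately obtain f where f: "solution m V (\<lambda>u v. c u v - edge w y u v) p (\<lambda>v. q v + 0 * ind y v)
              (\<lambda>v. b v - ind w v + (0 + 1) * ind y v) f" using IH_c by blast
          have "solution m V c p q b (\<lambda>u v. f u v + arc w y u v)"
            by (rule solution_arc[OF fV wy'(1-3) f]) simp
          then show ?thesis by blast
        qed
      qed
    qed
  qed
qed

text \<open>Lexicographic induction on the number of vertices, the weight and the root degree. The
  order of the components matters: contraction may enlarge the root degree, and so may the insertion
  of artificial arcs, which comes with a loss of weight.\<close>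

theorem modulo_orientation:
  fixes V :: "'a set"
  assumes "admissible m V c p q b x0" "m \<ge> 2"
  shows "\<exists>f. solution m V c p q b f"
proof -
  define R where "R = less_than <*lex*> less_than <*lex*> less_than"
  have "wf R" unfolding R_def by (intro wf_lex_prod wf_less_than)
  then have "\<forall>(V :: 'a set) c p q b x0. admissible m V c p q b x0 \<longrightarrow>
      (card V, nat (total_weight V c), nat (sum p V + sum q V)) = t \<longrightarrow> (\<exists>f. solution m V c p q b f)" for t
  proof (induction t rule: wf_induct_rule)
    case (less t)
    have IH: "\<exists>f. solution m V' c' p' q' b' f"
      if "admissible m V' c' p' q' b' x'" "((card V', nat (total_weight V' c'), nat (sum p' V' + sum q' V')), t) \<in> R"
      for V' :: "'a set" and c' p' q' b' x'
      by (rule less[OF that(2), rule_format, OF that(1) refl])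
    show ?case
    proof (intro allI impI)
      fix V :: "'a set" and c p q b x0
      assume adm: "admissible m V c p q b x0"
        and t: "(card V, nat (total_weight V c), nat (sum p V + sum q V)) = t"
      show "\<exists>f. solution m V c p q b f"
      proof (rule orientation_step[OF adm \<open>m \<ge> 2\<close>])
        fix V' :: "'a set" and c' p' q' b' x'
        assume "admissible m V' c' p' q' b' x'" "card V' < card V"
        then show "\<exists>f. solution m V' c' p' q' b' f"
          using IH unfolding t[symmetric] R_def by auto
      next
        fix c' p' q' b' x'
        assume a: "admissible m V c' p' q' b' x'" "total_weight V c' < total_weight V c"
        then have "nat (total_weight V c') < nat (total_weight V c)" using total_weight_nonneg[OF a(1)] by simp
        then show "\<exists>f. solution m V c' p' q' b' f"
          using IH[OF a(1)] unfolding t[symmetric] R_def by auto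
      next
        fix p' q' b' x'
        assume a: "admissible m V c p' q' b' x'" "sum p' V + sum q' V < sum p V + sum q V"
        then have "nat (sum p' V + sum q' V) < nat (sum p V + sum q V)"
          using root_sum_nonneg[OF a(1)] by simp
        then show "\<exists>f. solution m V c p' q' b' f"
          using IH[OF a(1)] unfolding t[symmetric] R_def by auto
      qed
    qed
  qed
  then show ?thesis using assms(1) by blast
qed

subsection \<open>From orientations to factors\<close>

text \<open>Switching the sides of the vertices in \<open>A\<close> turns a maximum cut
  \<open>X\<close> into \<open>X'\<close>, whose cut contains the symmetric difference of the cuts
  of \<open>X\<close> and \<open>A\<close>. By maximality at most as many edges of the cut of
  \<open>A\<close> lie outside the cut of \<open>X\<close> as inside it.\<close>

lemma max_cut_half:
  assumes G: "multigraph G"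
  obtains X where "X \<subseteq> verts G"
    "\<And>A. A \<subseteq> verts G \<Longrightarrow> card (edge_cut G A) \<le> 2 * card (edge_cut G X \<inter> edge_cut G A)"
proof -
  have fin: "finite (verts G)" "finite (edges G)" using G by (simp_all add: multigraph_def)
  have fcut: "finite (edge_cut G A)" for A
    by (rule finite_subset[OF _ fin(2)]) (auto simp: edge_cut_def)
  define N where "N = (\<lambda>X. card (edge_cut G X)) ` Pow (verts G)"
  have N: "finite N" "N \<noteq> {}" using fin by (auto simp: N_def)
  then have "Max N \<in> N" by (rule Max_in)
  then obtain X where X: "X \<subseteq> verts G" "card (edge_cut G X) = Max N" by (auto simp: N_def)
  have "card (edge_cut G A) \<le> 2 * card (edge_cut G X \<inter> edge_cut G A)" if A: "A \<subseteq> verts G" for A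
  proof -
    define X' where "X' = (X - A) \<union> (A - X)"
    have "X' \<subseteq> verts G" using X A by (auto simp: X'_def)
    then have "card (edge_cut G X') \<le> Max N" using N by (intro Max_ge) (auto simp: N_def)
    moreover have "(edge_cut G X - edge_cut G A) \<union> (edge_cut G A - edge_cut G X) \<subseteq> edge_cut G X'"
    proof
      fix e assume e: "e \<in> (edge_cut G X - edge_cut G A) \<union> (edge_cut G A - edge_cut G X)"
      then obtain x y where xy: "e \<in> edges G" "x \<in> verts G" "y \<in> verts G" "ends G e = {x, y}"
        "(x \<in> X) \<noteq> (y \<in> X) \<and> ((x \<in> A) = (y \<in> A)) \<or> (x \<in> A) \<noteq> (y \<in> A) \<and> ((x \<in> X) = (y \<in> X))"
        using X A unfolding edge_cut_def by (auto; blast)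
      then have "(x \<in> X') \<noteq> (y \<in> X')" by (auto simp: X'_def)
      then show "e \<in> edge_cut G X'"
        using xy unfolding edge_cut_def by (cases "x \<in> X'") (auto simp: insert_commute)
    qed
    then have "card ((edge_cut G X - edge_cut G A) \<union> (edge_cut G A - edge_cut G X)) \<le> card (edge_cut G X')"
      using fcut by (intro card_mono)
    moreover have "card ((edge_cut G X - edge_cut G A) \<union> (edge_cut G A - edge_cut G X))
        = card (edge_cut G X - edge_cut G A) + card (edge_cut G A - edge_cut G X)"
      using fcut by (intro card_Un_disjoint) auto
    moreover have "card (edge_cut G X) = card (edge_cut G X - edge_cut G A) + card (edge_cut G X \<inter> edge_cut G A)"
      "card (edge_cut G A) = card (edge_cut G A - edge_cut G X) + card (edge_cut G X \<inter> edge_cut G A)"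
      using card_Diff_subset_Int[of "edge_cut G X" "edge_cut G A"] card_Diff_subset_Int[of "edge_cut G A" "edge_cut G X"]
        fcut card_mono[OF fcut, of "edge_cut G X \<inter> edge_cut G A" X] card_mono[OF fcut, of "edge_cut G X \<inter> edge_cut G A" A]
      by (simp_all add: Int_commute)
    ultimately show ?thesis using X(2) by linarith
  qed
  then show ?thesis using that X(1) by blast
qed

text \<open>\<open>g x y\<close> is the number of factor edges between \<open>x\<close> and
  \<open>y\<close>, so the conclusion says that all degrees of the factor are congruent to
  \<open>k\<close> modulo \<open>2 * k\<close>.\<close>

lemma bipartite_flow:
  fixes k :: nat and c :: "'a \<Rightarrow> 'a \<Rightarrow> int"
  assumes k: "k > 0" and fV: "finite V" "even (card V)"
    and XY: "X \<inter> Y = {}" "X \<union> Y = V"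
    and sym: "\<And>u v. c u v = c v u" and nonneg: "\<And>u v. 0 \<le> c u v"
    and bip: "\<And>u v. u \<in> V \<Longrightarrow> v \<in> V \<Longrightarrow> (u \<in> X) = (v \<in> X) \<Longrightarrow> c u v = 0"
    and conn: "\<And>A. A \<noteq> {} \<Longrightarrow> A \<subset> V \<Longrightarrow> 5 * int k - 1 \<le> cut_weight V c A"
    and ess: "\<And>A. A \<noteq> {} \<Longrightarrow> A \<subset> V \<Longrightarrow> cut_weight V c A < 6 * int k - 3 \<Longrightarrow>
      \<exists>v\<in>V. \<forall>a\<in>A. \<forall>u\<in>V - A. c a u \<noteq> 0 \<longrightarrow> v = a \<or> v = u"
  shows "\<exists>g. (\<forall>x\<in>X. \<forall>y\<in>Y. 0 \<le> g x y \<and> g x y \<le> c x y) \<and>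
    (\<forall>x\<in>X. 2 * int k dvd (\<Sum>y\<in>Y. g x y) - int k) \<and>
    (\<forall>y\<in>Y. 2 * int k dvd (\<Sum>x\<in>X. g x y) - int k)"
proof -
  define s :: "'a \<Rightarrow> int" where "s v = (if v \<in> X then 1 else - 1)" for v
  define d where "d v = (\<Sum>u\<in>V. c v u)" for v
  \<comment> \<open>If factor edges are directed from \<open>X\<close> to \<open>Y\<close> and the
    others back, a vertex of degree \<open>d v\<close> with factor degree \<open>h\<close> has net
    outflow \<open>s v * (2 * h - d v)\<close>. A factor degree \<open>h\<close> congruent to
    \<open>k\<close> modulo \<open>2 * k\<close> thus means the demand \<open>b v\<close> modulo
    \<open>4 * k\<close>.\<close>
  define b where "b v = s v * (2 * int k - d v)" for v
  have sc: "s u * c u v = - (s v * c u v)" if "u \<in> V" "v \<in> V" for u v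
    using bip[OF that] by (auto simp: s_def)
  have sumb: "sum b A = 2 * int k * sum s A - (\<Sum>a\<in>A. \<Sum>u\<in>V - A. s a * c a u)" if A: "A \<subseteq> V" for A
  proof -
    \<comment> \<open>The contribution of the edges inside \<open>A\<close>. It vanishes because
      their two ends have opposite signs.\<close>
    define S where "S = (\<Sum>a\<in>A. \<Sum>u\<in>A. s a * c a u)"
    have "S = (\<Sum>a\<in>A. \<Sum>u\<in>A. s u * c u a)" unfolding S_def by (rule sum.swap)
    also have "\<dots> = (\<Sum>a\<in>A. \<Sum>u\<in>A. - (s a * c a u))"
    proof (intro sum.cong refl)
      fix a u assume "a \<in> A" "u \<in> A"
      then show "s u * c u a = - (s a * c a u)" using A sc[of u a] sym[of u a] by auto
    qed
    also have "\<dots> = - S" by (simp add: S_def sum_negf)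
    finally have "S = 0" by simp
    have fA: "finite A" using A fV(1) by (rule finite_subset)
    have "s a * d a = (\<Sum>u\<in>A. s a * c a u) + (\<Sum>u\<in>V - A. s a * c a u)" if "a \<in> A" for a
      using A fV(1) by (simp add: d_def sum_distrib_left sum.subset_diff[of A V] add.commute distrib_left)
    then have "(\<Sum>a\<in>A. s a * d a) = S + (\<Sum>a\<in>A. \<Sum>u\<in>V - A. s a * c a u)"
      by (simp add: S_def sum.distrib)
    moreover have "sum b A = 2 * int k * sum s A - (\<Sum>a\<in>A. s a * d a)"
    proof -
      have "b a = 2 * int k * s a - s a * d a" for a by (simp add: b_def algebra_simps)
      then show ?thesis by (simp add: sum_subtractf sum_distrib_left)
    qed
    ultimately show ?thesis using \<open>S = 0\<close> by simp
  qed
  have par: "even (cut_weight V c A - sum b A)" if A: "A \<subseteq> V" for A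
  proof -
    have "even (\<Sum>a\<in>A. \<Sum>u\<in>V - A. c a u + s a * c a u)"
      by (intro dvd_sum) (auto simp: s_def)
    then have "even (cut_weight V c A + (\<Sum>a\<in>A. \<Sum>u\<in>V - A. s a * c a u))"
      by (simp add: cut_weight_def sum.distrib)
    then show ?thesis unfolding sumb[OF A] by simp
  qed
  \<comment> \<open>This is where the even order enters: the total demand is \<open>2 * k\<close>
    times this sum and has to be divisible by \<open>4 * k\<close>.\<close>
  have "even (sum s V)"
  proof -
    have "even (\<Sum>v\<in>V. s v + 1)" by (intro dvd_sum) (auto simp: s_def)
    then show ?thesis using fV(2) by (simp add: sum.distrib)
  qed
  then obtain j where "sum s V = 2 * j" by blast
  then have tot: "4 * int k dvd sum b V" unfolding sumb[OF subset_refl] by simp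
  define M where "M = 2 * (2 * int k)"
  have M: "M > 0" using k by (simp add: M_def)
  have cut: "2 * (2 * int k) - 2 + dist_mult M (sum b A) \<le> cut_weight V c A" if A: "A \<noteq> {}" "A \<subset> V" for A
  proof (cases "cut_weight V c A < 6 * int k - 3")
    case False
    \<comment> \<open>The distance is at most \<open>2 * k\<close>, so cuts of size at least
      \<open>6 * k - 2\<close> are large enough. A cut of size \<open>6 * k - 3\<close> is odd,
      hence so is the distance, which is then at most \<open>2 * k - 1\<close>.\<close>
    have "2 * dist_mult M (sum b A) \<le> M" by (rule dist_mult_le_half)
    moreover have "even (dist_mult M (sum b A)) \<longleftrightarrow> even (cut_weight V c A)"
      using par[of A] A even_dist_mult[of M "sum b A"] by (auto simp: M_def)
    ultimately show ?thesis
      using False by (cases "cut_weight V c A = 6 * int k - 3"; cases "dist_mult M (sum b A) = 2 * int k") (auto simp: M_def)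
  next
    case True
    define n where "n = cut_weight V c A"
    obtain v where v: "v \<in> V" "\<And>a u. a \<in> A \<Longrightarrow> u \<in> V - A \<Longrightarrow> c a u \<noteq> 0 \<Longrightarrow> v = a \<or> v = u"
      using ess[OF A True] by blast
    \<comment> \<open>The common sign of the ends in \<open>A\<close> of all cut edges: this end is
      \<open>v\<close> itself if \<open>v\<close> lies in \<open>A\<close>, and a neighbour of
      \<open>v\<close> in the other part if not.\<close>
    define z where "z = (if v \<in> A then s v else - s v)"
    have z: "z = 1 \<or> z = - 1" by (auto simp: z_def s_def)
    have "(\<Sum>a\<in>A. \<Sum>u\<in>V - A. s a * c a u) = (\<Sum>a\<in>A. \<Sum>u\<in>V - A. z * c a u)"
    proof (intro sum.cong refl)
      fix a u assume au: "a \<in> A" "u \<in> V - A"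
      then have "a \<in> V" "u \<in> V" using A by auto
      show "s a * c a u = z * c a u"
      proof (cases "c a u = 0")
        case False
        then have "v = a \<or> v = u" by (rule v(2)[OF au])
        then show ?thesis using au sc[OF \<open>a \<in> V\<close> \<open>u \<in> V\<close>] by (auto simp: z_def)
      qed simp
    qed
    also have "\<dots> = z * n" by (simp add: n_def cut_weight_def sum_distrib_left)
    finally have sb: "sum b A = 2 * int k * sum s A - z * n" using sumb[of A] A by auto
    have n: "5 * int k - 1 \<le> n" "n < 6 * int k - 3" using conn[OF A] True by (simp_all add: n_def)
    show ?thesis
    proof (cases "even (sum s A)")
      case True
      then obtain j where j: "sum s A = 2 * j" by blast
      \<comment> \<open>The demand of \<open>A\<close> is congruent to \<open>- z * n\<close>, and
        the shift by \<open>4 * k\<close> brings it near 0. The resulting bound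
        \<open>n - 4 * k\<close> on the distance is just good enough for every such
        \<open>n\<close>.\<close>
      have "M dvd sum b A - (- (z * (n - 4 * int k)))"
      proof
        show "sum b A - (- (z * (n - 4 * int k))) = M * (j - z)"
          unfolding sb j M_def by (simp add: algebra_simps)
      qed
      then have "dist_mult M (sum b A) = dist_mult M (- (z * (n - 4 * int k)))" by (rule dist_mult_cong)
      also have "\<dots> \<le> \<bar>- (z * (n - 4 * int k))\<bar>" by (rule dist_mult_le_abs[OF M])
      also have "\<dots> = \<bar>n - 4 * int k\<bar>" using z by auto
      finally show ?thesis using n k unfolding n_def[symmetric] by linarith
    next
      case False
      then obtain j where j: "sum s A = 2 * j + 1" by (rule oddE)
      \<comment> \<open>The demand is congruent to \<open>2 * k - z * n\<close>, and
        \<open>2 * k\<close> to \<open>6 * k * z\<close> for both signs; the quotients of the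
        differences by \<open>4 * k\<close> are the two constants in the witness. The distance is at
        most \<open>6 * k - n\<close>, and \<open>4 * k - 2 + (6 * k - n) \<le> n\<close> amounts to
        \<open>n \<ge> 5 * k - 1\<close>.\<close>
      have "M dvd sum b A - (- (z * (n - 6 * int k)))"
      proof
        show "sum b A - (- (z * (n - 6 * int k))) = M * (j - (if z = 1 then 1 else - 2))"
          using z unfolding sb j M_def by (auto simp: algebra_simps)
      qed
      then have "dist_mult M (sum b A) = dist_mult M (- (z * (n - 6 * int k)))" by (rule dist_mult_cong)
      also have "\<dots> \<le> \<bar>- (z * (n - 6 * int k))\<bar>" by (rule dist_mult_le_abs[OF M])
      also have "\<dots> = \<bar>n - 6 * int k\<bar>" using z by auto
      finally show ?thesis using n k unfolding n_def[symmetric] by linarith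
    qed
  qed
  \<comment> \<open>No edge is directed beforehand, and all cut conditions hold, so
    \<open>x0\<close> is arbitrary.\<close>
  have "admissible (2 * int k) V c (\<lambda>_. 0) (\<lambda>_. 0) b x0" for x0
    unfolding admissible_def
  proof (intro conjI)
    show "\<forall>u v. c u v = c v u \<and> 0 \<le> c u v" by (intro allI conjI sym nonneg)
    show "2 * (2 * int k) dvd (\<Sum>v\<in>V. b v + 0 - 0)" using tot by simp
    show "\<forall>A\<subseteq>V. even (boundary_degree V c (\<lambda>_. 0) (\<lambda>_. 0) A - sum b A)" using par by (simp add: boundary_degree_def)
    show "(\<Sum>v\<in>V. 0) + (\<Sum>v\<in>V. 0) \<le> 2 * (2 * int k) - 2 + dist_mult (2 * (2 * int k)) ((\<Sum>v\<in>V. 0) - (\<Sum>v\<in>V. 0))"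
      using k dist_mult_nonneg[OF M, of 0] by (simp add: M_def)
    show "\<forall>A. A \<noteq> {} \<and> A \<subset> V \<and> \<not> (A = {x0} \<and> 2 * (2 * int k) dvd b x0) \<longrightarrow>
      2 * (2 * int k) - 2 + dist_mult (2 * (2 * int k)) (sum b A) \<le> boundary_degree V c (\<lambda>_. 0) (\<lambda>_. 0) A"
      using cut by (simp add: boundary_degree_def M_def)
  qed (use fV in simp_all)
  then obtain f where f: "solution (2 * int k) V c (\<lambda>_. 0) (\<lambda>_. 0) b f"
    using modulo_orientation[of "2 * int k" V c "\<lambda>_. 0" "\<lambda>_. 0" b] k by force
  have fin: "finite X" "finite Y" using fV(1) XY by auto
  have f0: "f u v - f v u = 0" if "u \<in> V" "v \<in> V" "(u \<in> X) = (v \<in> X)" for u v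
  proof (cases "u = v")
    case False
    then show ?thesis
      using solutionD(1,2)[OF f that(1,2)] solutionD(1)[OF f that(2,1)] bip[OF that] by auto
  qed simp
  have c0: "(\<Sum>u\<in>X. c v u) = 0" if "v \<in> X" for v
    using that XY by (intro sum.neutral ballI bip) auto
  have c0': "(\<Sum>u\<in>Y. c v u) = 0" if "v \<in> Y" for v
    using that XY by (intro sum.neutral ballI bip) auto
  have split: "sum h V = sum h X + sum h Y" for h :: "'a \<Rightarrow> int"
    unfolding XY(2)[symmetric] using fin XY(1) by (rule sum.union_disjoint)
  have ne: "x \<noteq> y" if "x \<in> X" "y \<in> Y" for x y using that XY(1) by blast
  show ?thesis
  proof (intro exI[of _ f] conjI ballI)
    fix x y assume "x \<in> X" "y \<in> Y"
    then have "x \<in> V" "y \<in> V" "x \<noteq> y" using XY by auto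
    then show "0 \<le> f x y" "f x y \<le> c x y"
      using solutionD(1,2)[OF f, of x y] solutionD(1)[OF f, of y x] by auto
  next
    fix x assume x: "x \<in> X"
    then have xV: "x \<in> V" using XY by auto
    have "(\<Sum>u\<in>X. f x u - f u x) = 0" using x XY by (intro sum.neutral ballI f0) auto
    moreover have "(\<Sum>u\<in>Y. f x u - f u x) = (\<Sum>u\<in>Y. 2 * f x u - c x u)"
    proof (rule sum.cong[OF refl])
      fix u assume "u \<in> Y"
      then show "f x u - f u x = 2 * f x u - c x u"
        using solutionD(2)[OF f xV, of u] ne[OF x] XY by fastforce
    qed
    ultimately have "net V f x = 2 * (\<Sum>u\<in>Y. f x u) - d x"
      using c0[OF x] by (simp add: net_def d_def split sum_subtractf sum_distrib_left)
    moreover have "b x = 2 * int k - d x" using x by (simp add: b_def s_def)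
    ultimately have "net V f x - (b x + 0 - 0) = 2 * ((\<Sum>u\<in>Y. f x u) - int k)" by simp
    then have "2 * (2 * int k) dvd 2 * ((\<Sum>u\<in>Y. f x u) - int k)"
      using solutionD(3)[OF f xV] by (simp only:)
    then show "2 * int k dvd (\<Sum>y\<in>Y. f x y) - int k" by (simp only: dvd_mult_cancel_left) simp
  next
    fix y assume y: "y \<in> Y"
    then have yV: "y \<in> V" "y \<notin> X" using XY by auto
    have "(\<Sum>u\<in>Y. f y u - f u y) = 0" using y XY by (intro sum.neutral ballI f0) auto
    moreover have "(\<Sum>u\<in>X. f y u - f u y) = (\<Sum>u\<in>X. c y u - 2 * f u y)"
    proof (rule sum.cong[OF refl])
      fix u assume "u \<in> X"
      then show "f y u - f u y = c y u - 2 * f u y"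
        using solutionD(2)[OF f yV(1), of u] ne[OF _ y] XY by fastforce
    qed
    ultimately have "net V f y = d y - 2 * (\<Sum>u\<in>X. f u y)"
      using c0'[OF y] by (simp add: net_def d_def split sum_subtractf sum_distrib_left)
    moreover have "b y = d y - 2 * int k" using yV(2) by (simp add: b_def s_def)
    ultimately have "net V f y - (b y + 0 - 0) = - (2 * ((\<Sum>u\<in>X. f u y) - int k))" by simp
    then have "2 * (2 * int k) dvd - (2 * ((\<Sum>u\<in>X. f u y) - int k))"
      using solutionD(3)[OF f yV(1)] by (simp only:)
    then show "2 * int k dvd (\<Sum>x\<in>X. f x y) - int k"
      by (simp only: dvd_minus_iff dvd_mult_cancel_left) simp
  qed
qed

text \<open>Passes between edge sets and multiplicities: \<open>c\<close> counts parallel edges, the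
  cut weights of \<open>c\<close> are the sizes of the edge cuts, and the numbers
  \<open>g x y\<close> are realised by choosing that many edges from each parallel class.\<close>

lemma bipartite_factor:
  fixes k :: nat and G :: "('v, 'e) mgraph"
  assumes k: "k > 0" and G: "multigraph G" and order: "even (graph_order G)"
    and bip: "bipartite G" and conn: "edge_connected (5 * k - 1) G"
    and ess: "essentially_edge_connected (6 * k - 3) G"
  shows "\<exists>F. is_factor F G \<and> modulo_regular k F \<and> (\<forall>v\<in>verts F. \<not> 2 * k dvd vertex_degree F v)"
proof -
  define V where "V = verts G"
  define E where "E u v = {e \<in> edges G. ends G e = {u, v}}" for u v
  define c where "c u v = int (card (E u v))" for u v
  have fin: "finite V" "finite (edges G)" using G by (simp_all add: multigraph_def V_def)
  obtain X Y where "X \<inter> Y = {} \<and> X \<union> Y = verts G \<and>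
      (\<forall>e\<in>edges G. \<exists>x\<in>X. \<exists>y\<in>Y. ends G e = {x, y})"
    using bip unfolding bipartite_def by (elim exE) (rule that)
  then have XY: "X \<inter> Y = {}" "X \<union> Y = V"
    and ends: "\<And>e. e \<in> edges G \<Longrightarrow> \<exists>x\<in>X. \<exists>y\<in>Y. ends G e = {x, y}"
    by (simp_all add: V_def)
  have ne: "x \<noteq> y" if "x \<in> X" "y \<in> Y" for x y using that XY(1) by blast
  have finXY: "finite X" "finite Y" using fin(1) XY by auto
  have finE: "finite (E u v)" for u v using fin(2) by (simp add: E_def)
  have Esym: "E u v = E v u" for u v by (simp add: E_def insert_commute)
  have Eeq: "u = u' \<and> v = v' \<or> u = v' \<and> v = u'" if "e \<in> E u v" "e \<in> E u' v'" for e u v u' v'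
  proof -
    have "{u, v} = {u', v'}" using that by (simp add: E_def)
    then show ?thesis by (simp add: doubleton_eq_iff)
  qed
  have Edisj: "E u v \<inter> E u' v' = {}"
    if "u \<in> A" "u' \<in> A" "v \<notin> A" "v' \<notin> A" "u \<noteq> u' \<or> v \<noteq> v'" for u v u' v' A
    using Eeq that by blast
  have cut: "cut_weight V c A = int (card (edge_cut G A))" if "A \<subseteq> V" for A
  proof -
    have fA: "finite A" "finite (V - A)" using that fin finite_subset by auto
    have "edge_cut G A = (\<Union>a\<in>A. \<Union>u\<in>V - A. E a u)"
      by (auto simp: edge_cut_def E_def V_def)
    moreover have "card (\<Union>a\<in>A. \<Union>u\<in>V - A. E a u) = (\<Sum>a\<in>A. card (\<Union>u\<in>V - A. E a u))"
    proof (intro card_UN_disjoint ballI impI)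
      fix a a' assume "a \<in> A" "a' \<in> A" "a \<noteq> a'"
      then show "(\<Union>u\<in>V - A. E a u) \<inter> (\<Union>u\<in>V - A. E a' u) = {}" using Edisj[of a A a'] by blast
    qed (use fA finE in auto)
    moreover have "card (\<Union>u\<in>V - A. E a u) = (\<Sum>u\<in>V - A. card (E a u))" if "a \<in> A" for a
    proof (intro card_UN_disjoint ballI impI)
      fix u u' assume "u \<in> V - A" "u' \<in> V - A" "u \<noteq> u'"
      then show "E a u \<inter> E a u' = {}" using that by (intro Edisj[of a A]) auto
    qed (use fA finE in auto)
    ultimately show ?thesis by (simp add: cut_weight_def c_def)
  qed
  have cX: "c u v = 0" if "u \<in> V" "v \<in> V" "(u \<in> X) = (v \<in> X)" for u v
  proof -
    have "E u v = {}"
    proof (rule ccontr)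
      assume "E u v \<noteq> {}"
      then obtain e where "e \<in> edges G" "ends G e = {u, v}" by (auto simp: E_def)
      then obtain x y where "x \<in> X" "y \<in> Y" "{u, v} = {x, y}" using ends by metis
      then show False using that(3) XY(1) by (auto simp: doubleton_eq_iff)
    qed
    then show ?thesis by (simp add: c_def)
  qed
  have connc: "5 * int k - 1 \<le> cut_weight V c A" if "A \<noteq> {}" "A \<subset> V" for A
  proof -
    have "5 * k - 1 \<le> card (edge_cut G A)" using conn that by (simp add: edge_connected_def V_def)
    then show ?thesis using cut[of A] that k by auto
  qed
  have essc: "\<exists>v\<in>V. \<forall>a\<in>A. \<forall>u\<in>V - A. c a u \<noteq> 0 \<longrightarrow> v = a \<or> v = u"
    if A: "A \<noteq> {}" "A \<subset> V" and small: "cut_weight V c A < 6 * int k - 3" for A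
  proof -
    have "card (edge_cut G A) < 6 * k - 3" using small cut[of A] A by auto
    then have "\<exists>v\<in>verts G. \<forall>e\<in>edge_cut G A. v \<in> ends G e"
      using ess[unfolded essentially_edge_connected_def, THEN spec, of A] A by (simp add: V_def)
    then obtain v where v: "v \<in> V" "\<And>e. e \<in> edge_cut G A \<Longrightarrow> v \<in> ends G e"
      unfolding V_def by blast
    have "v = a \<or> v = u" if au: "a \<in> A" "u \<in> V - A" "c a u \<noteq> 0" for a u
    proof -
      have "E a u \<noteq> {}" using au(3) by (intro notI) (simp add: c_def)
      then obtain e where "e \<in> E a u" by blast
      then have "e \<in> edge_cut G A" "ends G e = {a, u}" using au by (auto simp: E_def edge_cut_def V_def)
      then show ?thesis using v(2)[of e] by auto
    qed
    then show ?thesis using v(1) by blast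
  qed
  have csym: "c u v = c v u" and cpos: "0 \<le> c u v" for u v
    using Esym[of u v] by (simp_all add: c_def)
  have evV: "even (card V)" using order by (simp add: graph_order_def V_def)
  have "\<exists>g. (\<forall>x\<in>X. \<forall>y\<in>Y. 0 \<le> g x y \<and> g x y \<le> c x y) \<and>
    (\<forall>x\<in>X. 2 * int k dvd (\<Sum>y\<in>Y. g x y) - int k) \<and>
    (\<forall>y\<in>Y. 2 * int k dvd (\<Sum>x\<in>X. g x y) - int k)"
    by (rule bipartite_flow[of k V X Y c, OF k fin(1) evV XY csym cpos cX connc essc])
  then obtain g where g: "\<And>x y. x \<in> X \<Longrightarrow> y \<in> Y \<Longrightarrow> 0 \<le> g x y \<and> g x y \<le> c x y"
    and gX: "\<And>x. x \<in> X \<Longrightarrow> 2 * int k dvd (\<Sum>y\<in>Y. g x y) - int k"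
    and gY: "\<And>y. y \<in> Y \<Longrightarrow> 2 * int k dvd (\<Sum>x\<in>X. g x y) - int k"
    by blast
  have "\<exists>T. \<forall>x\<in>X. \<forall>y\<in>Y. T x y \<subseteq> E x y \<and> int (card (T x y)) = g x y"
  proof -
    have "\<exists>S. S \<subseteq> E x y \<and> int (card S) = g x y" if "x \<in> X" "y \<in> Y" for x y
    proof -
      have "nat (g x y) \<le> card (E x y)" using g[OF that] unfolding c_def by linarith
      then obtain S where "S \<subseteq> E x y" "card S = nat (g x y)" by (rule obtain_subset_with_card_n)
      then show ?thesis using g[OF that] by auto
    qed
    then show ?thesis by metis
  qed
  then obtain T where T: "\<And>x y. x \<in> X \<Longrightarrow> y \<in> Y \<Longrightarrow> T x y \<subseteq> E x y"
    "\<And>x y. x \<in> X \<Longrightarrow> y \<in> Y \<Longrightarrow> int (card (T x y)) = g x y" by blast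
  define F where "F = G\<lparr>edges := (\<Union>x\<in>X. \<Union>y\<in>Y. T x y)\<rparr>"
  have finT: "finite (T x y)" if "x \<in> X" "y \<in> Y" for x y
    using T(1)[OF that] finE by (rule finite_subset)
  have eF: "edges F \<subseteq> edges G"
    using T(1) by (auto simp: F_def E_def)
  have F: "is_factor F G"
    using G eF finite_subset[OF eF] unfolding is_factor_def multigraph_def by (auto simp: F_def)
  have deg: "2 * int k dvd int (vertex_degree F v) - int k" if v: "v \<in> V" for v
  proof -
    have noloop: "{e \<in> edges F. ends F e = {v}} = {}"
    proof -
      have "ends G e \<noteq> {v}" if e: "e \<in> edges G" for e
      proof
        assume "ends G e = {v}"
        then obtain x y where "x \<in> X" "y \<in> Y" "{v} = {x, y}" using ends[OF e] by metis
        then show False using ne by auto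
      qed
      then show ?thesis using eF by (auto simp: F_def)
    qed
    show ?thesis
    proof (cases "v \<in> X")
      case True
      have "{e \<in> edges F. v \<in> ends F e} = (\<Union>y\<in>Y. T v y)"
        using True T(1) ne by (fastforce simp: F_def E_def)
      moreover have "card (\<Union>y\<in>Y. T v y) = (\<Sum>y\<in>Y. card (T v y))"
      proof (rule card_UN_disjoint)
        show "\<forall>i\<in>Y. \<forall>j\<in>Y. i \<noteq> j \<longrightarrow> T v i \<inter> T v j = {}"
          using T(1)[OF True] Edisj[of v X v] True XY(1) by blast
      qed (use finXY finT True in auto)
      ultimately have "int (vertex_degree F v) = (\<Sum>y\<in>Y. g v y)"
        using T(2)[OF True] unfolding vertex_degree_def noloop by simp
      then show ?thesis using gX[OF True] by simp
    next
      case False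
      then have v': "v \<in> Y" using v XY by blast
      have "{e \<in> edges F. v \<in> ends F e} = (\<Union>x\<in>X. T x v)"
        using v' T(1) ne by (fastforce simp: F_def E_def)
      moreover have "card (\<Union>x\<in>X. T x v) = (\<Sum>x\<in>X. card (T x v))"
      proof (rule card_UN_disjoint)
        show "\<forall>i\<in>X. \<forall>j\<in>X. i \<noteq> j \<longrightarrow> T i v \<inter> T j v = {}"
          using T(1)[OF _ v'] Edisj[of _ X _ v v] False by blast
      qed (use finXY finT v' in auto)
      ultimately have "int (vertex_degree F v) = (\<Sum>x\<in>X. g x v)"
        using T(2)[OF _ v'] unfolding vertex_degree_def noloop by simp
      then show ?thesis using gY[OF v'] by simp
    qed
  qed
  have reg: "k dvd vertex_degree F v" "\<not> 2 * k dvd vertex_degree F v" if v: "v \<in> V" for v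
  proof -
    have "int k dvd int (vertex_degree F v) - int k"
      using deg[OF v] by (rule dvd_mult_right)
    then have "int k dvd int (vertex_degree F v) - int k + int k" by (rule dvd_add) simp
    then show "k dvd vertex_degree F v" by simp
    show "\<not> 2 * k dvd vertex_degree F v"
    proof
      assume "2 * k dvd vertex_degree F v"
      then have "int (2 * k) dvd int (vertex_degree F v)" by (simp only: int_dvd_int_iff)
      then have "2 * int k dvd int (vertex_degree F v)" by simp
      then have "2 * int k dvd int (vertex_degree F v) - (int (vertex_degree F v) - int k)"
        using deg[OF v] by (rule dvd_diff)
      then have "2 * int k dvd int k" by simp
      then have "2 * int k \<le> int k" using k by (intro zdvd_imp_le) auto
      then show False using k by simp
    qed
  qed
  have "verts F = V" by (simp add: F_def V_def)
  \<comment> \<open>Positivity comes for free, since 0 is divisible by \<open>2 * k\<close>.\<close>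
  moreover have "vertex_degree F v > 0" if "v \<in> V" for v
    using reg(2)[OF that] by (cases "vertex_degree F v = 0") auto
  ultimately show ?thesis using F reg unfolding modulo_regular_def by blast
qed

theorem theorem6p5:
  fixes k :: nat and G :: "('v, 'e) mgraph"
  assumes "k > 0" and "multigraph G" and "even (graph_order G)"
  shows "(edge_connected (10 * k - 3) G \<and> essentially_edge_connected (12 * k - 7) G \<longrightarrow>
            (\<exists>F. is_factor F G \<and> modulo_regular k F \<and>
                 (\<forall>v\<in>verts F. \<not> 2 * k dvd vertex_degree F v)))
       \<and> (bipartite G \<and> edge_connected (5 * k - 1) G \<and> essentially_edge_connected (6 * k - 3) G \<longrightarrow>
            (\<exists>F. is_factor F G \<and> modulo_regular k F \<and>
                 (\<forall>v\<in>verts F. \<not> 2 * k dvd vertex_degree F v)))"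
proof (intro conjI impI)
  assume "bipartite G \<and> edge_connected (5 * k - 1) G \<and> essentially_edge_connected (6 * k - 3) G"
  then show "\<exists>F. is_factor F G \<and> modulo_regular k F \<and> (\<forall>v\<in>verts F. \<not> 2 * k dvd vertex_degree F v)"
    using bipartite_factor[OF assms] by blast
next
  assume "edge_connected (10 * k - 3) G \<and> essentially_edge_connected (12 * k - 7) G"
  then have conn: "edge_connected (10 * k - 3) G" and ess: "essentially_edge_connected (12 * k - 7) G"
    by auto
  obtain X where X: "X \<subseteq> verts G"
    and half: "\<And>A. A \<subseteq> verts G \<Longrightarrow> card (edge_cut G A) \<le> 2 * card (edge_cut G X \<inter> edge_cut G A)"
    using max_cut_half[OF assms(2)] by blast
  \<comment> \<open>The bipartite subgraph formed by a maximum cut, in which every edge cut keeps at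
    least half of its size.\<close>
  define H where "H = G\<lparr>edges := edge_cut G X\<rparr>"
  have sub: "edge_cut G X \<subseteq> edges G" by (auto simp: edge_cut_def)
  have HG: "multigraph H"
    using assms(2) sub finite_subset[OF sub] unfolding multigraph_def by (auto simp: H_def)
  have cutH: "edge_cut H A = edge_cut G X \<inter> edge_cut G A" for A
    using sub by (auto simp: H_def edge_cut_def)
  have "bipartite H"
    unfolding bipartite_def
    by (intro exI[of _ X] exI[of _ "verts G - X"]) (use X in \<open>auto simp: H_def edge_cut_def\<close>)
  moreover have "edge_connected (5 * k - 1) H"
    unfolding edge_connected_def
  proof (intro allI impI)
    fix A assume A: "A \<noteq> {} \<and> A \<subset> verts H"
    then have A': "A \<noteq> {} \<and> A \<subset> verts G" by (simp add: H_def)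
    then have "10 * k - 3 \<le> card (edge_cut G A)" using conn unfolding edge_connected_def by blast
    also have "\<dots> \<le> 2 * card (edge_cut H A)" unfolding cutH using A' by (intro half) auto
    \<comment> \<open>Half of \<open>10 * k - 3\<close>, rounded up to an integer.\<close>
    finally show "5 * k - 1 \<le> card (edge_cut H A)" using \<open>k > 0\<close> by linarith
  qed
  moreover have "essentially_edge_connected (6 * k - 3) H"
    unfolding essentially_edge_connected_def
  proof (intro allI impI)
    fix A assume A: "A \<noteq> {} \<and> A \<subset> verts H \<and> card (edge_cut H A) < 6 * k - 3"
    then have A': "A \<noteq> {} \<and> A \<subset> verts G" by (simp add: H_def)
    have "card (edge_cut G A) \<le> 2 * card (edge_cut H A)" unfolding cutH using A' by (intro half) auto
    \<comment> \<open>A cut of \<open>H\<close> below \<open>6 * k - 3\<close> has at most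
      \<open>6 * k - 4\<close> edges, so the cut of \<open>G\<close> has at most
      \<open>12 * k - 8\<close>.\<close>
    then have "card (edge_cut G A) < 12 * k - 7" using A by linarith
    then obtain v where "v \<in> verts G" "\<forall>e\<in>edge_cut G A. v \<in> ends G e"
      using ess A' unfolding essentially_edge_connected_def by blast
    then show "\<exists>v\<in>verts H. \<forall>e\<in>edge_cut H A. v \<in> ends H e"
      unfolding cutH by (auto simp: H_def)
  qed
  moreover have "even (graph_order H)" using assms(3) by (simp add: graph_order_def H_def)
  ultimately obtain F where F: "is_factor F H" "modulo_regular k F"
      "\<forall>v\<in>verts F. \<not> 2 * k dvd vertex_degree F v"
    using bipartite_factor[OF assms(1) HG] by blast
  have "is_factor F G"
    using F(1) sub by (auto simp: is_factor_def H_def)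
  then show "\<exists>F. is_factor F G \<and> modulo_regular k F \<and> (\<forall>v\<in>verts F. \<not> 2 * k dvd vertex_degree F v)"
    using F by blast
qed

end
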